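(* Let $\alpha>0$ and let $g,\varphi:\mathbb C\to\mathbb C$ be entire functions. For $\lambda\in\mathbb C\setminus\{0\}$ put $$\sigma_{\lambda,g}(w)=\frac{1}{\alpha\lambda\bar w}\exp\!\Bigl[\alpha\frac{\lambda-1}{\lambda}|w|^2\Bigr]g'\!\Bigl(\frac w\lambda\Bigr),\qquad w\neq 0.$$ The following are equivalent. (i) There exists $f\in L^\infty(\mathbb C,dA)$ such that $V_{(g,\varphi)}=T_f$ on $F^2_\alpha$. (ii) Either $g$ is constant, or there exists $\lambda\in\mathbb C\setminus\{0\}$ such that $\varphi(z)=\lambda z$ and $\sigma_{\lambda,g}\in L^\infty(\mathbb C,dA)$. In the nonzero case $g'\not\equiv 0$, the bounded symbol is unique and equals $\sigma_{\lambda,g}$ almost everywhere. Moreover, in the case $g'\not\equiv0$, the condition $\sigma_{\lambda,g}\in L^\infty(\mathbb C,dA)$ (with $\lambda\ne0$) automatically implies $$g'(0)=0,\qquad \operatorname{Re}\lambda\ge|\lambda|^2>0.$$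
   Context: Fix $\alpha>0$. Let $dA$ denote Lebesgue area measure on $\mathbb C$, $d\lambda_\alpha(z)=\frac{\alpha}{\pi}e^{-\alpha|z|^2}dA(z)$, and let $F^2_\alpha$ be the Fock space of all entire functions in $L^2(\mathbb C,d\lambda_\alpha)$. For $f\in L^\infty(\mathbb C,dA)$ the Toeplitz operator $T_f$ on $F^2_\alpha$ is the bounded operator $$T_fh(z)=\frac{\alpha}{\pi}\int_{\mathbb C}f(u)h(u)e^{\alpha z\bar u-\alpha|u|^2}\,dA(u).$$ The generalized Volterra-type operator is $$V_{(g,\varphi)}h(z)=\int_0^z h(\varphi(\zeta))g'(\zeta)\,d\zeta .$$ The statement "$V_{(g,\varphi)}=T_f$ on $F^2_\alpha$" means $V_{(g,\varphi)}h=T_fh$ for every $h\in F^2_\alpha$. *)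

theory Defs
  imports "HOL-Complex_Analysis.Complex_Analysis"
begin

text \<open>
  Area measure on the complex plane is \<^term>\<open>lebesgue :: complex measure\<close>. Elements of the space
  \<open>L\<^sup>\<infinity>\<close> are represented by functions; equality in \<open>L\<^sup>\<infinity>\<close> is equality almost everywhere.
\<close>

definition Linf :: "(complex \<Rightarrow> complex) set" where
  "Linf = {f. f \<in> borel_measurable lebesgue \<and> (\<exists>C::real. AE u in lebesgue. norm (f u) \<le> C)}"

definition gauss_measure :: "real \<Rightarrow> complex measure" where
  "gauss_measure \<alpha> = density lebesgue (\<lambda>z. ennreal (\<alpha> / pi * exp (- \<alpha> * (norm z)\<^sup>2)))"

definition Fock :: "real \<Rightarrow> (complex \<Rightarrow> complex) set" where
  "Fock \<alpha> = {h. h holomorphic_on UNIV \<and> integrable (gauss_measure \<alpha>) (\<lambda>z. (norm (h z))\<^sup>2)}"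

text \<open>For \<open>f \<in> Linf\<close> and \<open>h \<in> Fock \<alpha>\<close> with \<open>\<alpha> > 0\<close> the integrand below is integrable.\<close>

definition toeplitz :: "real \<Rightarrow> (complex \<Rightarrow> complex) \<Rightarrow> (complex \<Rightarrow> complex) \<Rightarrow> complex \<Rightarrow> complex" where
  "toeplitz \<alpha> f h z =
     of_real (\<alpha> / pi) *
     (LINT u|lebesgue. f u * h u *
        exp (of_real \<alpha> * z * cnj u - of_real (\<alpha> * (norm u)\<^sup>2)))"

text \<open>
  For entire \<open>g\<close>, \<open>\<phi>\<close>, \<open>h\<close> the integrand is entire, so the integral from \<open>0\<close> to \<open>z\<close> is independent
  of the path; the straight segment is used.
\<close>

definition volterra :: "(complex \<Rightarrow> complex) \<Rightarrow> (complex \<Rightarrow> complex) \<Rightarrow> (complex \<Rightarrow> complex) \<Rightarrow> complex \<Rightarrow> complex" where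
  "volterra g \<phi> h z = contour_integral (linepath 0 z) (\<lambda>\<zeta>. h (\<phi> \<zeta>) * deriv g \<zeta>)"

definition volterra_eq_toeplitz ::
  "real \<Rightarrow> (complex \<Rightarrow> complex) \<Rightarrow> (complex \<Rightarrow> complex) \<Rightarrow> (complex \<Rightarrow> complex) \<Rightarrow> bool" where
  "volterra_eq_toeplitz \<alpha> g \<phi> f \<longleftrightarrow> (\<forall>h\<in>Fock \<alpha>. volterra g \<phi> h = toeplitz \<alpha> f h)"

text \<open>
  The symbol is only meaningful for \<open>w \<noteq> 0\<close>; at the null set \<open>{0}\<close> it takes the value \<open>0\<close>
  because division by zero yields zero.
\<close>

definition sigma_symbol :: "real \<Rightarrow> complex \<Rightarrow> (complex \<Rightarrow> complex) \<Rightarrow> complex \<Rightarrow> complex" where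
  "sigma_symbol \<alpha> lam g w =
     1 / (of_real \<alpha> * lam * cnj w) *
     exp (of_real \<alpha> * ((lam - 1) / lam) * of_real ((norm w)\<^sup>2)) *
     deriv g (w / lam)"

end

theory Submission
  imports Defs
begin

text \<open>
  Write \<open>e\<^sub>a(u) = exp (a u)\<close>. Differentiating \<open>V h = T\<^sub>f h\<close> in \<open>z\<close> turns the operator identity into

  \<open>h(\<phi>(z)) g'(z) = (\<alpha>\<^sup>2/\<pi>) \<integral> f(u) cnj u h(u) exp(\<alpha> z cnj u - \<alpha> |u|\<^sup>2) dA(u)\<close>,

  and all necessary conditions come from inserting polynomials and exponentials for \<open>h\<close>.

  \<^item> The powers \<open>h(u) = (u - p)^(2m)\<close> bound \<open>(\<phi> - p)^(2m) g'\<close> by \<open>D^m m!\<close> times a Gaussian factor. Choosing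
    \<open>p = \<phi>(z\<^sub>0)\<close>, dividing by \<open>(w - z\<^sub>0)^(2m)\<close> and using the maximum principle on the circle of radius
    \<open>sqrt m\<close> bounds \<open>|\<phi>'(z\<^sub>0)|\<close> independently of \<open>z\<^sub>0\<close>, so Liouville's theorem makes \<open>\<phi>(z) = \<lambda> z + b\<close>
    (\<open>deriv_phi_bound\<close>, \<open>phi_affine\<close>).

  \<^item> The exponential whose integrand is concentrated at \<open>\<phi>(z)\<close> gives
    \<open>|g'(z)| \<le> A (1 + |\<phi>(z)|) exp(\<alpha> Re(cnj z \<phi>(z)) - \<alpha> |\<phi>(z)|\<^sup>2)\<close> (\<open>deriv_growth\<close>). If \<open>Re \<lambda> < |\<lambda>|\<^sup>2\<close>,
    the right-hand side tends to \<open>0\<close>, so \<open>g' = 0\<close>. The remaining degenerate case \<open>\<lambda> = 0\<close> is again excluded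
    by Liouville's theorem.

  \<^item> For \<open>h = e\<^sub>a\<close> with \<open>a = - \<alpha> cnj z\<close> the right-hand side of the identity is a Fourier transform, which is
    injective on integrable functions (\<open>fourier_uniqueness\<close>). So a bounded symbol is determined by its operator, and \<open>f\<close> can
    be found by exhibiting one function with the right transform. This function comes from the reproducing
    formula \<open>\<integral> exp(- c |u|\<^sup>2 + c w cnj u) m(u) dA(u) = (\<pi>/c) m(w)\<close> for entire \<open>m\<close> and complex \<open>c\<close> with
    \<open>Re c > 0\<close>, taken at \<open>c = \<alpha>/\<lambda>\<close> (\<open>gaussian_reproducing\<close>, \<open>symbol_times_cnj\<close>). After translation and
    extraction of a holomorphic factor the formula is the mean value property of entire functions against a radial
    weight.

  \<^item> The constant of integration carries the last piece of information: \<open>V h\<close> vanishes at \<open>0\<close>. An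
    antiderivative of the reproducing formula in \<open>w\<close> (\<open>gaussian_reproducing_primitive\<close>) turns \<open>T\<^sub>f e\<^sub>a(0) = 0\<close> into
    \<open>b \<integral> g'((t - 1) b/\<lambda>) exp(a t b) dt = 0\<close> over \<open>0 \<le> t \<le> 1\<close>, for every \<open>a\<close>. Unless \<open>b = 0\<close> this forces
    \<open>g' = 0\<close>. With \<open>b = 0\<close> the function found before is \<open>\<sigma>\<close>.

  Conversely, the same antiderivative formula, applied to \<open>m(u) = g'(u/\<lambda>) h(u)\<close> and \<open>w = \<lambda> z\<close>, evaluates
  \<open>T\<^sub>\<sigma> h(z)\<close> to \<open>V h(z)\<close>. Finally a bounded \<open>\<sigma>\<close> forces \<open>g'(0) = 0\<close>, because of the pole \<open>1/cnj w\<close>, and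
  \<open>Re \<lambda> \<ge> |\<lambda>|\<^sup>2\<close>, because otherwise \<open>g'\<close> would decay like a Gaussian.
\<close>

section \<open>Rotations, radial means and complex Gaussian integrals\<close>

lemma nn_integral_lborel_translate:
  fixes h :: "'a::euclidean_space \<Rightarrow> ennreal"
  assumes [measurable]: "h \<in> borel_measurable borel"
  shows "(\<integral>\<^sup>+x. h (c + x) \<partial>lborel) = (\<integral>\<^sup>+x. h x \<partial>lborel)"
  by (subst (2) lborel_distr_plus[of c, symmetric]) (simp add: nn_integral_distr)

lemma nn_integral_lborel_reflect:
  fixes h :: "'a::euclidean_space \<Rightarrow> ennreal"
  assumes [measurable]: "h \<in> borel_measurable borel"
  shows "(\<integral>\<^sup>+x. h (c - x) \<partial>lborel) = (\<integral>\<^sup>+x. h x \<partial>lborel)"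
proof -
  have "lborel = density (distr lborel borel (\<lambda>x::'a. c - x)) (\<lambda>_. 1)"
    using lborel_affine[of "-1" c] by simp
  then have *: "lborel = distr lborel borel (\<lambda>x::'a. c - x)"
    by (simp add: density_1)
  show ?thesis
    by (subst (2) *) (simp add: nn_integral_distr)
qed

text \<open>
  The measure \<open>A \<mapsto> |f\<^sup>-\<^sup>1 A|\<close> is translation invariant and agrees with Lebesgue measure on the unit ball \<open>D\<close>.
  Integrating \<open>1\<^sub>A(f x) 1\<^sub>D(f x - y)\<close> over \<open>x\<close> and \<open>y\<close> in both orders compares the two measures of \<open>A\<close>, up to the
  common factor \<open>|D|\<close>.
\<close>

lemma lborel_distr_orthogonal_transformation:
  fixes f :: "'a::euclidean_space \<Rightarrow> 'a"
  assumes f: "orthogonal_transformation f"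
  shows "distr lborel borel f = lborel"
proof (rule measure_eqI)
  fix A assume "A \<in> sets (distr lborel borel f)"
  then have A[measurable]: "A \<in> sets borel" by simp
  have lin: "linear f" and normf: "\<And>x. norm (f x) = norm x"
    using f by (auto simp: orthogonal_transformation)
  have f_meas[measurable]: "f \<in> borel_measurable borel"
    using lin by (intro borel_measurable_continuous_onI linear_continuous_on) (simp add: linear_conv_bounded_linear)
  obtain f' where f': "\<And>y. f (f' y) = y"
    using orthogonal_transformation_surj[OF f] by (metis surj_def)
  define D where "D = ball (0::'a) 1"
  have D[measurable]: "D \<in> sets borel" by (simp add: D_def)
  have fD: "indicator D (f x) = (indicator D x :: ennreal)" for x
    by (simp add: D_def indicator_def normf)
  let ?I = "\<lambda>S x. indicator S x :: ennreal"
  have "emeasure (distr lborel borel f) A * emeasure lborel D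
      = (\<integral>\<^sup>+x. ?I A (f x) * emeasure lborel D \<partial>lborel)"
  proof -
    have "emeasure (distr lborel borel f) A = (\<integral>\<^sup>+x. ?I A x \<partial>distr lborel borel f)" by simp
    also have "\<dots> = (\<integral>\<^sup>+x. ?I A (f x) \<partial>lborel)" by (rule nn_integral_distr) simp_all
    finally show ?thesis by (simp add: nn_integral_multc)
  qed
  also have "\<dots> = (\<integral>\<^sup>+x. \<integral>\<^sup>+y. ?I A (f x) * ?I D (f x - y) \<partial>lborel \<partial>lborel)"
  proof (rule nn_integral_cong)
    fix x
    have "emeasure lborel D = (\<integral>\<^sup>+y. ?I D y \<partial>lborel)" by simp
    also have "\<dots> = (\<integral>\<^sup>+y. ?I D (f x - y) \<partial>lborel)"
      by (rule nn_integral_lborel_reflect[symmetric]) simp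
    finally show "?I A (f x) * emeasure lborel D = (\<integral>\<^sup>+y. ?I A (f x) * ?I D (f x - y) \<partial>lborel)"
      by (simp add: nn_integral_cmult)
  qed
  also have "\<dots> = (\<integral>\<^sup>+y. \<integral>\<^sup>+x. ?I A (f x) * ?I D (f x - y) \<partial>lborel \<partial>lborel)"
    by (rule lborel_pair.Fubini'[symmetric]) simp
  also have "\<dots> = (\<integral>\<^sup>+y. \<integral>\<^sup>+x. ?I A (y + f x) * ?I D (f x) \<partial>lborel \<partial>lborel)"
  proof (rule nn_integral_cong)
    fix y
    show "(\<integral>\<^sup>+x. ?I A (f x) * ?I D (f x - y) \<partial>lborel) = (\<integral>\<^sup>+x. ?I A (y + f x) * ?I D (f x) \<partial>lborel)"
      using nn_integral_lborel_translate[of "\<lambda>x. ?I A (f x) * ?I D (f x - y)" "f' y"]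
      by (simp add: linear_add[OF lin] f')
  qed
  also have "\<dots> = (\<integral>\<^sup>+x. \<integral>\<^sup>+y. ?I A (y + f x) * ?I D (f x) \<partial>lborel \<partial>lborel)"
    by (rule lborel_pair.Fubini') simp
  also have "\<dots> = (\<integral>\<^sup>+x. emeasure lborel A * ?I D x \<partial>lborel)"
  proof (rule nn_integral_cong)
    fix x
    have "(\<integral>\<^sup>+y. ?I A (y + f x) \<partial>lborel) = emeasure lborel A"
      using nn_integral_lborel_translate[of "?I A" "f x"] by (simp add: add.commute)
    then show "(\<integral>\<^sup>+y. ?I A (y + f x) * ?I D (f x) \<partial>lborel) = emeasure lborel A * ?I D x"
      by (simp add: nn_integral_multc fD)
  qed
  also have "\<dots> = emeasure lborel A * emeasure lborel D"
    by (simp add: nn_integral_cmult)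
  finally have *: "emeasure (distr lborel borel f) A * emeasure lborel D = emeasure lborel A * emeasure lborel D" .
  have "emeasure lborel D \<noteq> 0" "emeasure lborel D \<noteq> \<infinity>"
    using unit_ball_vol_pos[of "real DIM('a)"] by (auto simp: D_def emeasure_ball less_le)
  then show "emeasure (distr lborel borel f) A = emeasure lborel A"
    using * by (metis mult_divide_eq_ennreal infinity_ennreal_def)
qed simp

lemma lborel_distr_unimodular:
  assumes "norm (w::complex) = 1"
  shows "distr lborel borel (\<lambda>z. w * z) = lborel"
  by (rule lborel_distr_orthogonal_transformation)
     (use assms in \<open>auto simp: orthogonal_transformation linear_iff algebra_simps norm_mult\<close>)

text \<open>
  The disc \<open>|z|\<^sup>2 \<le> t\<close> has area \<open>\<pi> t\<close>. This replaces polar coordinates for radial integrands.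
\<close>

lemma distr_norm_sq_lborel:
  "distr lborel borel (\<lambda>z::complex. (norm z)\<^sup>2) = density lborel (\<lambda>t. ennreal (pi * indicator {0..} t))"
proof (rule measure_eqI_generator_eq[where \<Omega>=UNIV and E="range (\<lambda>t::real. {..t})" and A="\<lambda>n. {..real n}"])
  have e: "emeasure lborel {z::complex. (norm z)\<^sup>2 \<le> t} = ennreal (pi * max 0 t)" for t
  proof (cases "t \<ge> 0")
    case True
    have "{z::complex. (norm z)\<^sup>2 \<le> t} = cball 0 (sqrt t)"
      using True by (auto simp: real_le_rsqrt sqrt_ge_absD real_sqrt_le_iff')
    then show ?thesis using True
      by (simp add: emeasure_cball unit_ball_vol_2 )
  next
    case False
    then have "{z::complex. (norm z)\<^sup>2 \<le> t} = {}"
      by (auto simp: not_le intro: less_le_trans)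
    then show ?thesis using False by simp
  qed
  have e2: "emeasure (density lborel (\<lambda>t. ennreal (pi * indicator {0..} t))) {..t} = ennreal (pi * max 0 t)" for t
  proof -
    have "emeasure (density lborel (\<lambda>t. ennreal (pi * indicator {0..} t))) {..t}
       = (\<integral>\<^sup>+x. ennreal (pi * indicator {0..t} x) \<partial>lborel)"
      by (subst emeasure_density) (auto intro!: nn_integral_cong simp: indicator_def)
    also have "\<dots> = ennreal (pi * max 0 t)"
      by (simp add: nn_integral_cmult emeasure_lborel_Icc_eq ennreal_mult max_def ennreal_indicator)
    finally show ?thesis .
  qed
  show "Int_stable (range (\<lambda>t::real. {..t}))"
    by (auto simp: Int_stable_def)
  show "emeasure (distr lborel borel (\<lambda>z::complex. (norm z)\<^sup>2)) X =
      emeasure (density lborel (\<lambda>t. ennreal (pi * indicator {0..} t))) X" if "X \<in> range (\<lambda>t::real. {..t})" for X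
    using that e e2 by (auto simp: emeasure_distr vimage_def)
  show "sets (distr lborel borel (\<lambda>z::complex. (norm z)\<^sup>2)) = sigma_sets UNIV (range (\<lambda>t::real. {..t}))"
    by (simp add: borel_eq_atMost)
  show "sets (density lborel (\<lambda>t::real. ennreal (pi * indicator {0..} t))) = sigma_sets UNIV (range (\<lambda>t::real. {..t}))"
    by (simp add: borel_eq_atMost)
  show "(\<Union>i. {..real i}) = (UNIV::real set)"
    by (auto intro: real_arch_simple)
  show "emeasure (distr lborel borel (\<lambda>z::complex. (norm z)\<^sup>2)) {..real i} \<noteq> \<infinity>" for i
    using e by (auto simp: emeasure_distr vimage_def)
qed auto


text \<open>
  In the variable \<open>t = |z|\<^sup>2\<close> the integral is \<open>\<pi>\<close> times that of \<open>exp (- c t)\<close> over the half-line, so that complex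
  \<open>c\<close> needs no rotation of contours.
\<close>

lemma has_bochner_integral_complex_gaussian:
  assumes c: "Re c > 0"
  shows "has_bochner_integral lborel (\<lambda>z::complex. exp (- c * of_real ((norm z)\<^sup>2))) (of_real pi / c)"
proof -
  let ?f = "\<lambda>t::real. exp (- c * of_real t)"
  have c0: "c \<noteq> 0" using c by auto
  have int0: "set_integrable lborel {0..} (\<lambda>t. exp (- Re c * t))"
  proof -
    have "(\<integral>\<^sup>+t. ennreal (exp (- Re c * t)) * indicator {0..} t \<partial>lborel) = ennreal (0 - (- exp (- Re c * 0) / Re c))"
    proof (rule nn_integral_FTC_atLeast)
      show "((\<lambda>t. - exp (- Re c * t) / Re c) \<longlongrightarrow> 0) at_top" using c by real_asymp
    qed (use c in \<open>auto intro!: derivative_eq_intros\<close>)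
    moreover have "(\<integral>\<^sup>+t. ennreal (exp (- Re c * t)) * indicator {0..} t \<partial>lborel)
        = (\<integral>\<^sup>+t. ennreal (indicator {0..} t *\<^sub>R exp (- Re c * t)) \<partial>lborel)"
      by (intro nn_integral_cong) (simp add: indicator_def)
    ultimately have "(\<integral>\<^sup>+t. ennreal (indicator {0..} t *\<^sub>R exp (- Re c * t)) \<partial>lborel) < \<infinity>"
      by (metis ennreal_less_top infinity_ennreal_def)
    then show ?thesis unfolding set_integrable_def
      by (intro integrableI_nonneg) auto
  qed
  have int: "set_integrable lborel {0..} ?f"
    unfolding set_integrable_def
    by (rule Bochner_Integration.integrable_bound[OF int0[unfolded set_integrable_def]])
       (auto simp: indicator_def)
  have "(LBINT t=0..\<infinity>. ?f t) = 0 - (- exp (- c * of_real 0) / c)"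
  proof (rule interval_integral_FTC_integrable)
    show "((\<lambda>t. - exp (- c * of_real t) / c) has_vector_derivative ?f x) (at x)" for x
      unfolding has_real_derivative_iff_has_vector_derivative[symmetric]
      using c0 by (auto intro!: derivative_eq_intros has_vector_derivative_real_field simp: field_simps)
    show "set_integrable lborel (einterval 0 \<infinity>) ?f"
      by (rule set_integrable_subset[OF int]) (auto simp: einterval_def zero_ereal_def)
    show "(((\<lambda>t. - exp (- c * of_real t) / c) \<circ> real_of_ereal) \<longlongrightarrow> - exp (- c * of_real 0) / c) (at_right 0)"
      unfolding zero_ereal_def ereal_tendsto_simps
      by (intro tendsto_eq_intros) (auto simp: c0)
    have "((\<lambda>t. exp (- c * of_real t)) \<longlongrightarrow> 0) at_top"
    proof (rule tendsto_norm_zero_cancel)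
      have "((\<lambda>t. exp (- Re c * t)) \<longlongrightarrow> 0) at_top" using c by real_asymp
      then show "((\<lambda>t. norm (exp (- c * of_real t))) \<longlongrightarrow> 0) at_top" by simp
    qed
    then show "(((\<lambda>t. - exp (- c * of_real t) / c) \<circ> real_of_ereal) \<longlongrightarrow> 0) (at_left \<infinity>)"
      unfolding ereal_tendsto_simps       using tendsto_divide_zero[of "\<lambda>t::real. - exp (- c * of_real t)" at_top c] tendsto_minus by force
  qed (auto intro!: continuous_intros)
  then have "(LINT t:{0<..}|lborel. ?f t) = 1 / c"
    using interval_integral_to_infinity_eq[of lborel 0 ?f] by (simp add: zero_ereal_def)
  also have "(LINT t:{0<..}|lborel. ?f t) = (LINT t:{0..}|lborel. ?f t)"
    unfolding set_lebesgue_integral_def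
  proof (rule integral_cong_AE)
    show "AE t in lborel. indicator {0<..} t *\<^sub>R ?f t = indicator {0..} t *\<^sub>R ?f t"
      using AE_lborel_singleton[of 0] by eventually_elim (simp add: indicator_def)
  qed simp_all
  finally have val: "(LINT t|lborel. indicator {0..} t *\<^sub>R ?f t) = 1 / c"
    by (simp add: set_lebesgue_integral_def)
  have hb: "has_bochner_integral lborel (\<lambda>t. (pi * indicator {0..} t) *\<^sub>R ?f t) (of_real pi / c)"
    using int val unfolding set_integrable_def
    by (simp add: has_bochner_integral_iff scaleR_conv_of_real mult.assoc)
  have "has_bochner_integral (distr lborel borel (\<lambda>z::complex. (norm z)\<^sup>2)) ?f (of_real pi / c)"
    unfolding distr_norm_sq_lborel by (rule has_bochner_integral_density[OF _ _ _ hb]) auto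
  then show ?thesis
    by (simp add: has_bochner_integral_iff integrable_distr_eq integral_distr)
qed

lemma integral_circle_mean:
  assumes m: "m holomorphic_on UNIV"
  shows "(LINT t:{0..1}|lborel. m (cis (2 * pi * t) * v)) = m 0"
proof -
  have cont: "continuous_on UNIV m" using m by (rule holomorphic_on_imp_continuous_on)
  have hol: "(\<lambda>z. m (z * v)) holomorphic_on cball 0 1"
    by (rule holomorphic_on_compose[of "\<lambda>z. z * v" "cball 0 1" m, unfolded o_def])
       (auto intro!: holomorphic_intros holomorphic_on_subset[OF m])
  have "((\<lambda>z. m (z * v) / (z - 0)) has_contour_integral (2 * of_real pi * \<i> * m (0 * v))) (circlepath 0 1)"
    by (rule Cauchy_integral_circlepath_simple[OF hol]) simp
  moreover have "circlepath 0 1 t = cis (2 * pi * t)" for t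
    by (simp add: circlepath cis_conv_exp mult_ac)
  moreover have "vector_derivative (circlepath 0 1) (at t) = 2 * of_real pi * \<i> * cis (2 * pi * t)" for t
    by (simp add: vector_derivative_circlepath cis_conv_exp mult_ac)
  ultimately have "((\<lambda>t. m (cis (2 * pi * t) * v) / cis (2 * pi * t) * (2 * of_real pi * \<i> * cis (2 * pi * t)))
      has_integral (2 * of_real pi * \<i> * m 0)) {0..1}"
    unfolding has_contour_integral by simp
  then have "((\<lambda>t. (2 * of_real pi * \<i>) * m (cis (2 * pi * t) * v)) has_integral (2 * of_real pi * \<i> * m 0)) {0..1}"
    by (simp add: field_simps)
  from has_integral_mult_right[OF this, of "1 / (2 * of_real pi * \<i>)"]
  have *: "((\<lambda>t. m (cis (2 * pi * t) * v)) has_integral m 0) {0..1}"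
    by simp
  have "set_integrable lborel {0..1} (\<lambda>t. m (cis (2 * pi * t) * v))"
    by (rule borel_integrable_atLeastAtMost')
       (auto intro!: continuous_intros continuous_on_compose2[OF cont])
  then show ?thesis
    using * has_integral_unique set_borel_integral_eq_integral(2) by (metis integral_unique)
qed

text \<open>
  Rotation by \<open>2 \<pi> t\<close> does not change the left-hand side. Averaging over \<open>t\<close> and exchanging the integrals replaces
  \<open>m z\<close> by its mean over a circle. The value \<open>m 0\<close> stays inside the integral in order to cover weights with a
  non-integrable singularity at \<open>0\<close>, which occur together with \<open>m 0 = 0\<close>.
\<close>

lemma radial_mean_value:
  fixes \<rho> m :: "complex \<Rightarrow> complex"
  assumes m: "m holomorphic_on UNIV"
    and [measurable]: "\<rho> \<in> borel_measurable borel"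
    and radial: "\<And>w z. norm w = 1 \<Longrightarrow> \<rho> (w * z) = \<rho> z"
    and int: "integrable lborel (\<lambda>z. \<rho> z * m z)"
  shows "(LINT z|lborel. \<rho> z * m z) = (LINT z|lborel. \<rho> z * m 0)"
proof -
  have cont: "continuous_on UNIV m" using m by (rule holomorphic_on_imp_continuous_on)
  have [measurable]: "m \<in> borel_measurable borel" 
    using cont by (rule borel_measurable_continuous_onI)
  have rot: "integrable lborel (\<lambda>z. \<rho> z * m (w * z))" "(LINT z|lborel. \<rho> z * m (w * z)) = (LINT z|lborel. \<rho> z * m z)"
    "(LINT z|lborel. norm (\<rho> z * m (w * z))) = (LINT z|lborel. norm (\<rho> z * m z))"
    if w: "norm w = 1" for w
  proof -
    let ?D = "distr lborel borel (\<lambda>z. w * z)"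
    have D: "?D = lborel" by (rule lborel_distr_unimodular[OF w])
    show "integrable lborel (\<lambda>z. \<rho> z * m (w * z))" 
      using int by (subst (asm) D[symmetric]) (simp add: integrable_distr_eq radial[OF w])
    show "(LINT z|lborel. \<rho> z * m (w * z)) = (LINT z|lborel. \<rho> z * m z)"
      by (subst (2) D[symmetric]) (simp add: integral_distr radial[OF w])
    show "(LINT z|lborel. norm (\<rho> z * m (w * z))) = (LINT z|lborel. norm (\<rho> z * m z))"
      by (subst (2) D[symmetric]) (simp add: integral_distr radial[OF w])
  qed
  define I where "I = (LINT z|lborel. \<rho> z * m z)"
  let ?F = "\<lambda>t z. indicator {0..1::real} t *\<^sub>R (\<rho> z * m (cis (2 * pi * t) * z))"
  have [measurable]: "(\<lambda>t. cis (2 * pi * t)) \<in> borel_measurable borel"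
    by (intro borel_measurable_continuous_onI continuous_intros)
  have "I = (LINT t|lborel. LINT z|lborel. ?F t z)"
    by (simp add: rot I_def)
  also have "\<dots> = (LINT z|lborel. LINT t|lborel. ?F t z)"
  proof (rule lborel_pair.Fubini_integral[symmetric])
    show "integrable (lborel \<Otimes>\<^sub>M lborel) (\<lambda>(t, z). ?F t z)"
    proof (rule lborel_pair.Fubini_integrable)
      have "(\<lambda>t. LINT z|lborel. norm (case (t, z) of (t, z) \<Rightarrow> ?F t z))
          = (\<lambda>t. indicator {0..1::real} t *\<^sub>R (LINT z|lborel. norm (\<rho> z * m z)))"
        by (rule ext) (simp add: rot(3) indicator_def)
      then show "integrable lborel (\<lambda>t. LINT z|lborel. norm (case (t, z) of (t, z) \<Rightarrow> ?F t z))"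
        by simp
      show "AE t in lborel. integrable lborel (\<lambda>z. case (t, z) of (t, z) \<Rightarrow> ?F t z)"
        by (auto simp: rot)
    qed simp
  qed
  also have "\<dots> = (LINT z|lborel. \<rho> z * m 0)"
  proof (rule Bochner_Integration.integral_cong[OF refl])
    fix z
    have "(LINT t|lborel. ?F t z) = \<rho> z * (LINT t:{0..1}|lborel. m (cis (2 * pi * t) * z))"
      unfolding set_lebesgue_integral_def 
      by (subst integral_mult_right_zero[symmetric]) (simp add: mult_ac scaleR_conv_of_real)
    then show "(LINT t|lborel. ?F t z) = \<rho> z * m 0"
      by (simp add: integral_circle_mean[OF m])
  qed
  finally show ?thesis by (simp add: I_def)
qed

section \<open>Injectivity of the Fourier transform on integrable functions\<close>

lemma borel_measurable_lebesgueI: "f \<in> borel_measurable borel \<Longrightarrow> f \<in> borel_measurable lebesgue"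
  by (simp add: measurable_completion)

lemma borel_measurable_cnj [measurable]: "cnj \<in> borel_measurable borel"
  by (intro borel_measurable_continuous_onI continuous_intros)

text \<open>
  The ideal test function \<open>cnj (sgn F)\<close> turns the integral into that of \<open>|F|\<close>. It is an almost everywhere limit of
  continuous functions, which can be truncated to modulus at most \<open>1\<close>.
\<close>

lemma AE_zero_if_continuous_tests_zero:
  fixes F :: "'a::euclidean_space \<Rightarrow> complex"
  assumes F: "integrable lebesgue F"
    and test: "\<And>k::'a \<Rightarrow> complex. continuous_on UNIV k \<Longrightarrow> (\<And>x. norm (k x) \<le> 1) \<Longrightarrow>
                 (LINT x|lebesgue. k x * F x) = 0"
  shows "AE x in lebesgue. F x = 0"
proof -
  have [measurable]: "F \<in> borel_measurable lebesgue" using F by simp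
  define G where "G x = cnj (sgn (F x))" for x
  have [measurable]: "G \<in> borel_measurable lebesgue"
    unfolding G_def sgn_div_norm by simp
  have normG: "norm (G x) \<le> 1" for x by (simp add: G_def norm_sgn)
  have "G measurable_on UNIV"
    by (simp add: measurable_on_iff_borel_measurable)
  then obtain N g where N: "negligible N" and g: "\<And>n::nat. continuous_on UNIV (g n)"
    and lim: "\<And>x. x \<notin> N \<Longrightarrow> (\<lambda>n. g n x) \<longlonglongrightarrow> G x"
    by (auto simp: measurable_on_def)
  \<comment> \<open>the radial retraction onto the closed unit disc\<close>
  define T where "T z = z / of_real (max 1 (norm z))" for z :: complex
  have T: "continuous_on UNIV T" 
    unfolding T_def by (intro continuous_intros) (auto simp: max_def)
  have normT: "norm (T z) \<le> 1" for z
    by (auto simp: T_def norm_divide max_def divide_simps)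
  have cont: "continuous_on UNIV (\<lambda>x. T (g n x))" for n
    by (rule continuous_on_compose2[OF T g]) auto
  have [measurable]: "(\<lambda>x. T (g n x)) \<in> borel_measurable lebesgue" for n
    using borel_measurable_continuous_onI[OF cont[of n]] by (rule borel_measurable_lebesgueI) 
  have "(\<lambda>n. LINT x|lebesgue. T (g n x) * F x) \<longlonglongrightarrow> (LINT x|lebesgue. G x * F x)"
  proof (rule integral_dominated_convergence[where w="\<lambda>x. norm (F x)"])
    have "AE x in lebesgue. x \<notin> N"
      using N by (simp add: negligible_iff_null_sets AE_not_in)
    then show "AE x in lebesgue. (\<lambda>n. T (g n x) * F x) \<longlonglongrightarrow> G x * F x"
    proof eventually_elim
      fix x assume "x \<notin> N"
      have "(\<lambda>n. T (g n x)) \<longlonglongrightarrow> T (G x)"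
        using continuous_on_tendsto_compose[OF T lim[OF \<open>x \<notin> N\<close>]] by simp
      moreover have "T (G x) = G x" using normG[of x] by (simp add: T_def max_def)
      ultimately show "(\<lambda>n. T (g n x) * F x) \<longlonglongrightarrow> G x * F x"
        by (intro tendsto_intros) simp
    qed
    show "AE x in lebesgue. norm (T (g n x) * F x) \<le> norm (F x)" for n
      using normT by (auto simp: norm_mult mult_le_cancel_right1 intro!: AE_I2 mult_left_le_one_le)
  qed (use F in auto)
  moreover have "(LINT x|lebesgue. T (g n x) * F x) = 0" for n
    by (rule test[OF cont normT])
  ultimately have "(LINT x|lebesgue. G x * F x) = 0"
    using LIMSEQ_unique[OF tendsto_const] by (simp add: LIMSEQ_const_iff)
  moreover have "G x * F x = of_real (norm (F x))" for x
    by (simp add: G_def sgn_div_norm complex_norm_square[symmetric] power2_eq_square scaleR_conv_of_real field_simps mult.commute)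
  ultimately have "(LINT x|lebesgue. norm (F x)) = 0"
    by simp
  then have "AE x in lebesgue. norm (F x) = 0"
    by (subst (asm) integral_nonneg_eq_0_iff_AE) (use F in auto)
  then show ?thesis by simp
qed

text \<open>
  Treating the functions with vanishing Fourier transform as a set allows products with several trigonometric factors
  to be built one factor at a time.
\<close>

definition null_fourier :: "('a::euclidean_space \<Rightarrow> complex) set" where
  "null_fourier = {F. integrable lebesgue F \<and> (\<forall>\<xi>. (LINT x|lebesgue. cis (\<xi> \<bullet> x) * F x) = 0)}"

lemma integrable_bounded_mult:
  fixes F k :: "'a::euclidean_space \<Rightarrow> complex"
  assumes F: "integrable lebesgue F" and k: "k \<in> borel_measurable lebesgue" and b: "\<And>x. norm (k x) \<le> B"
  shows "integrable lebesgue (\<lambda>x. k x * F x)"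
proof (rule Bochner_Integration.integrable_bound)
  show "integrable lebesgue (\<lambda>x. B * norm (F x))" using F by simp
  show "(\<lambda>x. k x * F x) \<in> borel_measurable lebesgue" using F k by simp
  show "AE x in lebesgue. norm (k x * F x) \<le> norm (B * norm (F x))"
  proof (rule AE_I2)
    fix x
    have "norm (k x * F x) \<le> B * norm (F x)"
      using b by (simp add: norm_mult mult_right_mono)
    also have "\<dots> \<le> norm (B * norm (F x))" by simp
    finally show "norm (k x * F x) \<le> norm (B * norm (F x))" .
  qed
qed

lemma cis_inner_measurable [measurable]: "(\<lambda>x. cis (\<xi> \<bullet> x)) \<in> borel_measurable (lebesgue :: 'a::euclidean_space measure)"
  by (intro borel_measurable_lebesgueI borel_measurable_continuous_onI continuous_intros)

lemma integrable_cis_mult: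
  fixes F :: "'a::euclidean_space \<Rightarrow> complex"
  shows "integrable lebesgue F \<Longrightarrow> integrable lebesgue (\<lambda>x. cis (\<xi> \<bullet> x) * F x)"
  by (rule integrable_bounded_mult[where B=1]) auto

lemma null_fourier_add: "F \<in> null_fourier \<Longrightarrow> G \<in> null_fourier \<Longrightarrow> (\<lambda>x. F x + G x) \<in> null_fourier"
  by (simp add: null_fourier_def distrib_left integrable_cis_mult)

lemma null_fourier_cmult: "F \<in> null_fourier \<Longrightarrow> (\<lambda>x. c * F x) \<in> null_fourier"
  by (simp add: null_fourier_def mult.left_commute[of _ c])

lemma null_fourier_sum: 
  "(\<And>b. b \<in> B \<Longrightarrow> F b \<in> null_fourier) \<Longrightarrow> (\<lambda>x. \<Sum>b\<in>B. F b x) \<in> null_fourier"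
proof (induction B rule: infinite_finite_induct)
  case (insert b B)
  then show ?case by (simp add: null_fourier_add)
qed (auto simp: null_fourier_def)

lemma null_fourier_modulate: "F \<in> null_fourier \<Longrightarrow> (\<lambda>x. cis (\<eta> \<bullet> x) * F x) \<in> null_fourier"
  by (auto simp: null_fourier_def integrable_cis_mult mult.assoc[symmetric] cis_mult inner_add_left[symmetric])

lemma null_fourier_sin: 
  assumes "F \<in> null_fourier" shows "(\<lambda>x. of_real (sin (\<eta> \<bullet> x)) * F x) \<in> null_fourier"
proof -
  have *: "complex_of_real (sin t) = (1 / (2 * \<i>)) * cis t + (- 1 / (2 * \<i>)) * cis (- t)" for t
    by (simp add: complex_eq_iff Re_divide Im_divide power2_eq_square)
  have "of_real (sin (\<eta> \<bullet> x)) * F x = (1 / (2 * \<i>)) * (cis (\<eta> \<bullet> x) * F x) + (- 1 / (2 * \<i>)) * (cis ((- \<eta>) \<bullet> x) * F x)" for x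
    by (subst *) (simp add: algebra_simps)
  then show ?thesis
    by (simp only: ext) (intro null_fourier_add null_fourier_cmult null_fourier_modulate assms)
qed

text \<open>
  A polynomial in the functions \<open>sin (d (b \<bullet> x))\<close> is a trigonometric polynomial, hence multiplication by it preserves
  \<^const>\<open>null_fourier\<close>. The function \<open>F\<close> is arbitrary in the induction because a product multiplies \<open>F\<close> twice.
\<close>

lemma null_fourier_polynomial_sin:
  fixes p :: "'a::euclidean_space \<Rightarrow> real"
  assumes "real_polynomial_function p" and "F \<in> null_fourier"
  shows "(\<lambda>x. of_real (p (\<Sum>b\<in>Basis. sin ((d *\<^sub>R b) \<bullet> x) *\<^sub>R b)) * F x) \<in> null_fourier"
  using assms
proof (induction arbitrary: F rule: real_polynomial_function.induct)
  case (linear p)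
  then interpret p: bounded_linear p by simp
  have "(\<lambda>x. \<Sum>b\<in>Basis. of_real (p b) * (of_real (sin ((d *\<^sub>R b) \<bullet> x)) * F x)) \<in> null_fourier"
    by (intro null_fourier_sum null_fourier_cmult null_fourier_sin linear)
  then show ?case
    by (simp add: p.sum p.scaleR sum_distrib_right sum_distrib_left mult_ac del: inner_scaleR_left)
next
  case (const c)
  then show ?case by (simp add: null_fourier_cmult)
next
  case (add p q)
  then show ?case by (simp add: distrib_right null_fourier_add)
next
  case (mult p q)
  from mult(3)[OF mult(4)[OF mult(5)]] show ?case by (simp add: mult_ac)
qed

text \<open>
  By the Stone-Weierstrass theorem on a cube, \<open>F\<close> annihilates every continuous function of the sines
  \<open>sin (d x\<^sub>b)\<close> of the coordinates, in particular \<open>k (sin (d x\<^sub>b) / d)\<close> for bounded continuous \<open>k\<close>. Since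
  \<open>sin (d t) / d\<close> tends to \<open>t\<close> as \<open>d\<close> tends to \<open>0\<close>, dominated convergence shows that \<open>F\<close> annihilates \<open>k\<close> itself.
\<close>

theorem fourier_uniqueness:
  fixes F :: "'a::euclidean_space \<Rightarrow> complex"
  assumes F: "integrable lebesgue F"
    and zero: "\<And>\<xi>. (LINT x|lebesgue. cis (\<xi> \<bullet> x) * F x) = 0"
  shows "AE x in lebesgue. F x = 0"
proof -
  have FN: "F \<in> null_fourier" using F zero by (simp add: null_fourier_def)
  define I where "I = (LINT x|lebesgue. norm (F x))"
  define S where "S d x = (\<Sum>b\<in>Basis. sin ((d *\<^sub>R b) \<bullet> x) *\<^sub>R b)" for d and x :: 'a
  have contS: "continuous_on UNIV (S d)" for d unfolding S_def by (intro continuous_intros)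
  have S_in: "S d x \<in> cbox (- One) One" for d x
    by (simp add: S_def mem_box)
  have periodic: "(LINT x|lebesgue. of_real (k (S d x /\<^sub>R d)) * F x) = 0"
    if k: "continuous_on UNIV k" and kb: "\<And>x. \<bar>k x\<bar> \<le> 1" for k :: "'a \<Rightarrow> real" and d
  proof -
    have kS: "continuous_on UNIV (\<lambda>x. k (S d x /\<^sub>R d))"
      by (intro continuous_on_compose2[OF k] continuous_intros contS) auto
    have mk: "(\<lambda>x. complex_of_real (k (S d x /\<^sub>R d))) \<in> borel_measurable lebesgue"
      by (intro borel_measurable_lebesgueI borel_measurable_continuous_onI continuous_intros kS)
    have ik: "integrable lebesgue (\<lambda>x. of_real (k (S d x /\<^sub>R d)) * F x)"
      by (rule integrable_bounded_mult[OF F mk, of 1]) (simp add: kb)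
    have "norm (LINT x|lebesgue. of_real (k (S d x /\<^sub>R d)) * F x) \<le> e * I" if "e > 0" for e
    proof -
      have "continuous_on (cbox (- One) One) (\<lambda>y. k (y /\<^sub>R d))"
        by (intro continuous_on_compose2[OF k] continuous_intros) auto
      then obtain p where p: "real_polynomial_function p"
        and pe: "\<And>y. y \<in> cbox (- One) One \<Longrightarrow> \<bar>k (y /\<^sub>R d) - p y\<bar> < e"
        using Stone_Weierstrass_real_polynomial_function[OF compact_cbox _ \<open>e > 0\<close>] by blast
      have pN: "(\<lambda>x. of_real (p (S d x)) * F x) \<in> null_fourier"
        unfolding S_def by (rule null_fourier_polynomial_sin[OF p FN])
      then have p0: "(LINT x|lebesgue. of_real (p (S d x)) * F x) = 0"
        by (auto simp: null_fourier_def dest: spec[of _ 0])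
      have ip: "integrable lebesgue (\<lambda>x. of_real (p (S d x)) * F x)"
        using pN by (simp add: null_fourier_def)
      have "norm (LINT x|lebesgue. of_real (k (S d x /\<^sub>R d)) * F x)
          = norm (LINT x|lebesgue. of_real (k (S d x /\<^sub>R d)) * F x - of_real (p (S d x)) * F x)"
        using p0 ik ip by simp
      also have "\<dots> \<le> (LINT x|lebesgue. e * norm (F x))"
      proof (rule Bochner_Integration.integral_norm_bound_integral)
        fix x
        have "norm (of_real (k (S d x /\<^sub>R d) - p (S d x)) * F x) \<le> e * norm (F x)"
          unfolding norm_mult norm_of_real using pe[OF S_in[of d x]]
          by (intro mult_right_mono) auto
        then show "norm (of_real (k (S d x /\<^sub>R d)) * F x - of_real (p (S d x)) * F x) \<le> e * norm (F x)"
          by (simp add: left_diff_distrib)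
      qed (use ik ip F in auto)
      finally show ?thesis by (simp add: I_def)
    qed
    then have "norm (LINT x|lebesgue. of_real (k (S d x /\<^sub>R d)) * F x) \<le> 0 * I"
      by (intro tendsto_lowerbound[where f="\<lambda>e. e * I" and F="at_right 0"])
         (auto intro!: tendsto_eq_intros eventually_at_right_less elim: eventually_mono simp: eventually_at_right_field intro: exI[of _ 1])
    then show ?thesis by simp
  qed
  have S_lim: "(\<lambda>n. S (1 / Suc n) x /\<^sub>R (1 / Suc n)) \<longlonglongrightarrow> x" for x
  proof -
    have "(\<lambda>n. (real (Suc n) * sin ((1 / Suc n) * t))) \<longlonglongrightarrow> t" for t
      by real_asymp
    then have "(\<lambda>n. \<Sum>b\<in>Basis. (real (Suc n) * sin ((1 / Suc n) * (b \<bullet> x))) *\<^sub>R b) \<longlonglongrightarrow> (\<Sum>b\<in>Basis. (b \<bullet> x) *\<^sub>R b)"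
      by (intro tendsto_intros)
    also have "(\<Sum>b\<in>Basis. (b \<bullet> x) *\<^sub>R b) = x"
      by (simp add: inner_commute[of _ x] euclidean_representation)
    finally show ?thesis
      by (simp add: S_def scaleR_sum_right)
  qed
  have real_test: "(LINT x|lebesgue. of_real (k x) * F x) = 0"
    if k: "continuous_on UNIV k" and kb: "\<And>x. \<bar>k x\<bar> \<le> 1" for k :: "'a \<Rightarrow> real"
  proof -
    have "(\<lambda>n. LINT x|lebesgue. of_real (k (S (1 / Suc n) x /\<^sub>R (1 / Suc n))) * F x)
         \<longlonglongrightarrow> (LINT x|lebesgue. of_real (k x) * F x)"
    proof (rule integral_dominated_convergence[where w="\<lambda>x. norm (F x)"])
      have [measurable]: "F \<in> borel_measurable lebesgue" using F by simp
      have [measurable]: "k \<in> borel_measurable lebesgue"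
        by (intro borel_measurable_lebesgueI borel_measurable_continuous_onI k)
      show "(\<lambda>x. of_real (k x) * F x) \<in> borel_measurable lebesgue"
        by measurable
      have [measurable]: "(\<lambda>x. k (S (1 / Suc n) x /\<^sub>R (1 / Suc n))) \<in> borel_measurable lebesgue" for n
        by (intro borel_measurable_lebesgueI borel_measurable_continuous_onI continuous_intros
            continuous_on_compose2[OF k] contS) auto
      show "(\<lambda>x. of_real (k (S (1 / Suc n) x /\<^sub>R (1 / Suc n))) * F x) \<in> borel_measurable lebesgue" for n
        by measurable
      show "AE x in lebesgue. (\<lambda>n. of_real (k (S (1 / Suc n) x /\<^sub>R (1 / Suc n))) * F x) \<longlonglongrightarrow> of_real (k x) * F x"
        by (intro AE_I2 tendsto_intros continuous_on_tendsto_compose[OF k S_lim]) auto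
      show "AE x in lebesgue. norm (of_real (k (S (1 / Suc n) x /\<^sub>R (1 / Suc n))) * F x) \<le> norm (F x)" for n
        using kb by (intro AE_I2) (auto simp: norm_mult intro!: mult_left_le_one_le)
    qed (use F in auto)
    then show ?thesis by (simp only: periodic[OF k kb] LIMSEQ_const_iff)
  qed
  show ?thesis
  proof (rule AE_zero_if_continuous_tests_zero[OF F])
    fix k :: "'a \<Rightarrow> complex" assume k: "continuous_on UNIV k" and kb: "\<And>x. norm (k x) \<le> 1"
    have R: "continuous_on UNIV (\<lambda>x. Re (k x))" "continuous_on UNIV (\<lambda>x. Im (k x))"
      by (intro continuous_intros k)+
    have B: "\<bar>Re (k x)\<bar> \<le> 1" "\<bar>Im (k x)\<bar> \<le> 1" for x
      using kb[of x] abs_Re_le_cmod[of "k x"] abs_Im_le_cmod[of "k x"] by linarith+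
    have i: "integrable lebesgue (\<lambda>x. of_real (Re (k x)) * F x)" "integrable lebesgue (\<lambda>x. of_real (Im (k x)) * F x)"
      by (rule integrable_bounded_mult[OF F, of _ 1],
          intro borel_measurable_lebesgueI borel_measurable_continuous_onI continuous_intros R, simp add: B)+
    have "k x * F x = of_real (Re (k x)) * F x + \<i> * (of_real (Im (k x)) * F x)" for x
      by (subst complex_eq[of "k x"]) (simp add: algebra_simps)
    then show "(LINT x|lebesgue. k x * F x) = 0"
      using i real_test[OF R(1) B(1)] real_test[OF R(2) B(2)] by simp
  qed
qed

section \<open>Reproducing formulas for complex Gaussian weights\<close>

lemma of_real_norm_square: "(complex_of_real (norm u))\<^sup>2 = u * cnj u"
  by (metis complex_norm_square of_real_power)

lemma borel_measurable_entire: "m holomorphic_on UNIV \<Longrightarrow> m \<in> borel_measurable borel"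
  by (intro borel_measurable_continuous_onI holomorphic_on_imp_continuous_on)


lemma lborel_translate:
  fixes f :: "'a::euclidean_space \<Rightarrow> 'b::{banach,second_countable_topology}"
  assumes "f \<in> borel_measurable borel"
  shows "(LINT x|lborel. f (c + x)) = (LINT x|lborel. f x)"
    and "integrable lborel (\<lambda>x. f (c + x)) \<longleftrightarrow> integrable lborel f"
  using integral_distr[of "(+) c" lborel borel f] integrable_distr_eq[of "(+) c" lborel borel f] assms
  by (simp_all add: lborel_distr_plus)

text \<open>
  For \<open>c = \<alpha>\<close> this is the reproducing property of the Fock kernel. For complex \<open>c\<close> the substitution \<open>u = w + v\<close>
  cancels the antiholomorphic part of the exponent: what remains is the radial factor \<open>exp (- c |v|\<^sup>2)\<close> times a function
  that is entire in \<open>v\<close>.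
\<close>

lemma gaussian_reproducing:
  fixes m :: "complex \<Rightarrow> complex"
  assumes c: "Re c > 0" and m: "m holomorphic_on UNIV"
    and int: "integrable lborel (\<lambda>u. exp (- c * of_real ((norm u)\<^sup>2) + c * w * cnj u) * m u)"
  shows "(LINT u|lborel. exp (- c * of_real ((norm u)\<^sup>2) + c * w * cnj u) * m u) = of_real pi / c * m w"
proof -
  let ?f = "\<lambda>u. exp (- c * of_real ((norm u)\<^sup>2) + c * w * cnj u) * m u"
  let ?\<rho> = "\<lambda>v::complex. exp (- c * of_real ((norm v)\<^sup>2))"
  define M where "M v = exp (- c * cnj w * v) * m (w + v)" for v
  have M: "M holomorphic_on UNIV"
    unfolding M_def by (intro holomorphic_intros holomorphic_on_compose[OF _ holomorphic_on_subset[OF m], unfolded o_def]) auto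
  note [measurable] = borel_measurable_entire[OF m] borel_measurable_entire[OF M]
  have shift: "?f (w + v) = ?\<rho> v * M v" for v
    unfolding M_def mult.assoc[symmetric] exp_add[symmetric]
    by (simp add: of_real_norm_square algebra_simps)
  have "(LINT u|lborel. ?f u) = (LINT v|lborel. ?f (w + v))"
    by (rule lborel_translate(1)[symmetric]) measurable
  also have "\<dots> = (LINT v|lborel. ?\<rho> v * M v)"
    by (simp only: shift)
  also have "\<dots> = (LINT v|lborel. ?\<rho> v * M 0)"
  proof (rule radial_mean_value[OF M])
    have "integrable lborel (\<lambda>v. ?f (w + v))"
      using int by (subst lborel_translate(2)) measurable
    then show "integrable lborel (\<lambda>v. ?\<rho> v * M v)"
      by (simp only: shift)
  qed (auto simp: norm_mult)
  also have "\<dots> = of_real pi / c * m w"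
    using has_bochner_integral_complex_gaussian[OF c]
    by (simp add: has_bochner_integral_iff M_def)
  finally show ?thesis .
qed

lemma integral_exp_segment:
  assumes "(a::complex) \<noteq> 0"
  shows "(LINT t:{0..1::real}|lborel. exp (of_real t * a)) = (exp a - 1) / a"
proof -
  have "((\<lambda>t. exp (of_real t * a)) has_integral (exp (of_real 1 * a) / a - exp (of_real 0 * a) / a)) {0..1}"
  proof (rule fundamental_theorem_of_calculus)
    show "((\<lambda>t. exp (of_real t * a) / a) has_vector_derivative exp (of_real x * a)) (at x within {0..1})" for x
      by (rule has_vector_derivative_real_field[of "\<lambda>z. exp (z * a) / a"])
         (use assms in \<open>auto intro!: derivative_eq_intros\<close>)
  qed simp
  moreover have "set_integrable lborel {0..1} (\<lambda>t. exp (of_real t * a))"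
    by (rule borel_integrable_atLeastAtMost') (intro continuous_intros)
  ultimately show ?thesis
    by (metis (no_types, lifting) diff_divide_distrib exp_zero integral_unique mult_1 mult_zero_left of_real_0 of_real_1 set_borel_integral_eq_integral(2))
qed

text \<open>
  The derivative in \<open>w\<close> of the left-hand side is \<open>c\<close> times the integral in \<open>gaussian_reproducing\<close>, and at \<open>w = 0\<close> it
  vanishes because \<open>1/cnj u = u/|u|\<^sup>2\<close> is a radial weight times a function with a zero at the origin. Integrating
  along the segment from \<open>0\<close> to \<open>w\<close> by Fubini's theorem avoids differentiation under the integral sign. The hypothesis
  for all \<open>K\<close> dominates every exponential factor that occurs, whatever \<open>w\<close> is.
\<close>

lemma gaussian_reproducing_primitive:
  fixes m :: "complex \<Rightarrow> complex"
  assumes c: "Re c > 0" and m: "m holomorphic_on UNIV"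
    and int: "\<And>K. integrable lborel (\<lambda>u. exp (K * norm u) * norm (exp (- c * of_real ((norm u)\<^sup>2)) * m u / cnj u))"
  shows "(LINT u|lborel. exp (- c * of_real ((norm u)\<^sup>2) + c * w * cnj u) * m u / cnj u)
       = of_real pi * w * (LINT t:{0..1}|lborel. m (of_real t * w))"
proof -
  define E where "E u = exp (- c * of_real ((norm u)\<^sup>2)) * m u / cnj u" for u
  note [measurable] = borel_measurable_entire[OF m]
  have [measurable]: "E \<in> borel_measurable borel" unfolding E_def by measurable
  have int': "integrable lborel (\<lambda>u. exp (K * norm u) * norm (E u))" for K
    using int[of K] by (simp add: E_def)
  have intE: "integrable lborel E"
    by (rule Bochner_Integration.integrable_bound[OF int'[of 0]]) auto
  have E0: "(LINT u|lborel. E u) = 0"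
  proof -
    let ?\<rho> = "\<lambda>u::complex. exp (- c * of_real ((norm u)\<^sup>2)) / of_real ((norm u)\<^sup>2)"
    have E: "E = (\<lambda>u. ?\<rho> u * (u * m u))"
    proof
      show "E u = ?\<rho> u * (u * m u)" for u
        by (cases "u = 0") (simp_all add: E_def of_real_norm_square)
    qed
    have "(LINT u|lborel. ?\<rho> u * (u * m u)) = (LINT u|lborel. ?\<rho> u * (0 * m 0))"
    proof (rule radial_mean_value)
      show "(\<lambda>u. u * m u) holomorphic_on UNIV" by (intro holomorphic_intros m)
      show "integrable lborel (\<lambda>u. ?\<rho> u * (u * m u))" using intE by (simp only: E)
    qed (auto simp: norm_mult)
    then show ?thesis by (simp only: E) simp
  qed
  define F where "F t u = indicator {0..1::real} t *\<^sub>R (E u * cnj u * exp (of_real t * (c * w * cnj u)))" for t u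
  define B where "B u = exp ((norm (c * w) + 1) * norm u) * norm (E u)" for u
  have [measurable]: "(\<lambda>(t, u). F t u) \<in> borel_measurable (lborel \<Otimes>\<^sub>M lborel)"
    unfolding F_def by measurable
  have FB: "norm (F t u) \<le> indicator {0..1} t * B u" for t u
  proof (cases "t \<in> {0..1}")
    case True
    have "norm (exp (of_real t * (c * w * cnj u))) \<le> exp (norm (of_real t * (c * w * cnj u)))"
      by (rule norm_exp)
    also have "\<dots> \<le> exp (norm (c * w) * norm u)"
      using True by (simp add: norm_mult mult_left_le_one_le)
    finally have 1: "norm (exp (of_real t * (c * w * cnj u))) \<le> exp (norm (c * w) * norm u)" .
    have 2: "norm u \<le> exp (norm u)"
      using exp_ge_add_one_self[of "norm u"] by linarith
    have "norm (F t u) = norm (E u) * (norm u * norm (exp (of_real t * (c * w * cnj u))))"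
      using True by (simp add: F_def norm_mult)
    also have "\<dots> \<le> norm (E u) * (exp (norm u) * exp (norm (c * w) * norm u))"
      by (intro mult_left_mono mult_mono 1 2) auto
    also have "\<dots> = B u"
      by (simp add: B_def exp_add[symmetric] algebra_simps)
    finally show ?thesis using True by simp
  qed (simp add: F_def)
  have intF: "integrable (lborel \<Otimes>\<^sub>M lborel) (\<lambda>(t, u). F t u)"
  proof (rule Bochner_Integration.integrable_bound)
    show "integrable (lborel \<Otimes>\<^sub>M lborel) (\<lambda>(t, u). indicator {0..1::real} t * B u)"
    proof (rule lborel_pair.Fubini_integrable)
      show "(\<lambda>(t, u). indicator {0..1::real} t * B u) \<in> borel_measurable (lborel \<Otimes>\<^sub>M lborel)"
        unfolding B_def by measurable
      show "AE t in lborel. integrable lborel (\<lambda>u. case (t, u) of (t, u) \<Rightarrow> indicator {0..1::real} t * B u)"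
        using int' by (auto simp: B_def)
      show "integrable lborel (\<lambda>t. LINT u|lborel. norm (case (t, u) of (t, u) \<Rightarrow> indicator {0..1::real} t * B u))"
        by (simp add: abs_mult)
    qed
    show "AE x in lborel \<Otimes>\<^sub>M lborel. norm (case x of (t, u) \<Rightarrow> F t u) \<le> norm (case x of (t, u) \<Rightarrow> indicator {0..1::real} t * B u)"
      using FB by (auto intro!: AE_I2 order_trans[OF _ abs_ge_self])
  qed simp
  \<comment> \<open>this is \<open>exp y - 1\<close> written as \<open>y\<close> times the mean of \<open>exp (t y)\<close> over \<open>0 \<le> t \<le> 1\<close>\<close>
  have split: "exp (- c * of_real ((norm u)\<^sup>2) + c * w * cnj u) * m u / cnj u = E u + c * w * (LINT t|lborel. F t u)" for u
  proof (cases "u = 0 \<or> w = 0")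
    case True
    then show ?thesis by (auto simp: E_def F_def)
  next
    case False
    then have nz: "c * w * cnj u \<noteq> 0" using c by auto
    have "(LINT t|lborel. F t u) = E u * cnj u * (LINT t:{0..1}|lborel. exp (of_real t * (c * w * cnj u)))"
      unfolding set_lebesgue_integral_def F_def
      by (subst integral_mult_right_zero[symmetric]) (simp add: mult_ac scaleR_conv_of_real)
    then have "c * w * (LINT t|lborel. F t u) = E u * (exp (c * w * cnj u) - 1)"
      using False c by (auto simp: integral_exp_segment[OF nz])
    then have "E u + c * w * (LINT t|lborel. F t u) = E u * exp (c * w * cnj u)"
      by (simp only: right_diff_distrib) simp
    then show ?thesis by (simp only: exp_add E_def) simp
  qed
  have inner: "(LINT u|lborel. F t u) = indicator {0..1} t *\<^sub>R (of_real pi / c * m (of_real t * w))" for t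
  proof (cases "t \<in> {0..1}")
    case True
    \<comment> \<open>at \<open>u = 0\<close> the quotient in \<open>E\<close> is \<open>0\<close>, so the two integrands may differ there\<close>
    have nz: "AE u in lborel. u \<noteq> (0::complex)" by (rule AE_lborel_singleton)
    let ?h = "\<lambda>u. exp (- c * of_real ((norm u)\<^sup>2) + c * (of_real t * w) * cnj u) * m u"
    have ae: "AE u in lborel. F t u = ?h u"
      using nz 
    proof eventually_elim
      fix u :: complex assume "u \<noteq> 0"
      then have "F t u = exp (- c * of_real ((norm u)\<^sup>2)) * exp (c * (of_real t * w) * cnj u) * m u"
        using True by (simp add: F_def E_def mult_ac)
      then show "F t u = ?h u" by (simp only: exp_add)
    qed
    have "integrable lborel (F t)"
    proof (rule Bochner_Integration.integrable_bound)
      show "integrable lborel B" unfolding B_def by (rule int')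
      show "F t \<in> borel_measurable lborel" unfolding F_def by measurable
      show "AE u in lborel. norm (F t u) \<le> norm (B u)"
        using FB[of t] True by (auto intro!: AE_I2 order_trans[OF _ abs_ge_self])
    qed
    then have "integrable lborel ?h"
      by (subst (asm) integrable_cong_AE[OF _ _ ae]) (auto simp: F_def)
    then have "(LINT u|lborel. ?h u) = of_real pi / c * m (of_real t * w)"
      by (rule gaussian_reproducing[OF c m])
    moreover have "(LINT u|lborel. F t u) = (LINT u|lborel. ?h u)"
      by (rule integral_cong_AE[OF _ _ ae]) (auto simp: F_def)
    ultimately show ?thesis using True by simp
  qed (simp add: F_def)
  have "(LINT u|lborel. exp (- c * of_real ((norm u)\<^sup>2) + c * w * cnj u) * m u / cnj u)
      = (LINT u|lborel. E u + c * w * (LINT t|lborel. F t u))"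
    by (simp only: split)
  also have "\<dots> = (LINT u|lborel. E u) + c * w * (LINT u|lborel. LINT t|lborel. F t u)"
    using intE lborel_pair.integrable_snd[OF intF] by simp
  also have "(LINT u|lborel. LINT t|lborel. F t u) = (LINT t|lborel. LINT u|lborel. F t u)"
    by (rule lborel_pair.Fubini_integral[OF intF])
  also have "\<dots> = of_real pi / c * (LINT t:{0..1}|lborel. m (of_real t * w))"
    unfolding set_lebesgue_integral_def inner
    by (subst integral_mult_right_zero[symmetric]) (simp add: mult_ac scaleR_conv_of_real)
  finally show ?thesis using E0 c by (auto simp: field_simps)
qed

section \<open>The Volterra-type operator\<close>

lemma volterra_has_field_derivative:
  assumes "g holomorphic_on UNIV" "\<phi> holomorphic_on UNIV" "h holomorphic_on UNIV"
  shows "(volterra g \<phi> h has_field_derivative h (\<phi> z) * deriv g z) (at z)"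
proof -
  let ?F = "\<lambda>\<zeta>. h (\<phi> \<zeta>) * deriv g \<zeta>"
  have "?F holomorphic_on UNIV"
    using assms by (intro holomorphic_intros holomorphic_on_compose[of \<phi> UNIV h, unfolded o_def])
       (auto intro: holomorphic_on_subset)
  then obtain P where P: "\<And>x. (P has_field_derivative ?F x) (at x)"
    using holomorphic_convex_primitive'[of UNIV ?F] by auto
  have "volterra g \<phi> h = (\<lambda>z. P z - P 0)"
  proof
    fix z
    have "(?F has_contour_integral (P (pathfinish (linepath 0 z)) - P (pathstart (linepath 0 z)))) (linepath 0 z)"
      using P by (intro contour_integral_primitive[where S=UNIV] valid_path_linepath) auto
    then show "volterra g \<phi> h z = P z - P 0"
      by (simp add: volterra_def contour_integral_unique)
  qed
  then show ?thesis
    using P[of z] by (auto intro!: derivative_eq_intros)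
qed

lemma volterra_eq_set_integral:
  assumes "g holomorphic_on UNIV" "\<phi> holomorphic_on UNIV" "h holomorphic_on UNIV"
  shows "volterra g \<phi> h z = z * (LINT t:{0..1}|lborel. h (\<phi> (of_real t * z)) * deriv g (of_real t * z))"
proof -
  let ?F = "\<lambda>\<zeta>. h (\<phi> \<zeta>) * deriv g \<zeta>"
  have "?F holomorphic_on UNIV"
    using assms by (intro holomorphic_intros holomorphic_on_compose[of \<phi> UNIV h, unfolded o_def])
       (auto intro: holomorphic_on_subset)
  then have c: "continuous_on UNIV ?F" by (rule holomorphic_on_imp_continuous_on)
  have "set_integrable lborel {0..1} (\<lambda>t. ?F (of_real t * z))"
    by (rule borel_integrable_atLeastAtMost') (intro continuous_intros continuous_on_compose2[OF c]; simp)
  then have "(LINT t:{0..1}|lborel. ?F (of_real t * z)) = integral {0..1} (\<lambda>t. ?F (of_real t * z))"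
    by (rule set_borel_integral_eq_integral)
  then show ?thesis
    unfolding volterra_def contour_integral_integral
    by (simp add: linepath_def scaleR_conv_of_real mult.commute)
qed

section \<open>The Fock space and derivatives of Toeplitz transforms\<close>

lemma power_le_fact_mult_exp:
  assumes "x \<ge> (0::real)" shows "x ^ n \<le> fact n * exp x"
proof -
  have "(\<Sum>k\<in>{n}. x ^ k /\<^sub>R fact k) \<le> (\<Sum>k. x ^ k /\<^sub>R fact k)"
    using assms by (intro sum_le_suminf summable_exp_generic) auto
  then show ?thesis by (simp add: exp_def field_simps)
qed

lemma integrable_gaussian_exp:
  assumes \<beta>: "\<beta> > 0"
  shows "integrable lborel (\<lambda>u::complex. exp (K * norm u - \<beta> * (norm u)\<^sup>2))"
proof (rule Bochner_Integration.integrable_bound)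
  have "integrable lborel (\<lambda>u::complex. norm (exp (- of_real (\<beta> / 2) * complex_of_real ((norm u)\<^sup>2))))"
    using has_bochner_integral_complex_gaussian[of "of_real (\<beta> / 2)"] \<beta>
    by (intro integrable_norm) (auto simp: has_bochner_integral_iff)
  then show "integrable lborel (\<lambda>u::complex. exp (K\<^sup>2 / (2 * \<beta>)) * exp (- (\<beta> / 2) * (norm u)\<^sup>2))"
    by (intro integrable_mult_right) (simp add: Re_power2)
  show "AE u::complex in lborel. norm (exp (K * norm u - \<beta> * (norm u)\<^sup>2))
      \<le> norm (exp (K\<^sup>2 / (2 * \<beta>)) * exp (- (\<beta> / 2) * (norm u)\<^sup>2))"
  proof (rule AE_I2)
    fix u :: complex
    have "0 \<le> (K - \<beta> * norm u)\<^sup>2 / (2 * \<beta>)" using \<beta> by simp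
    also have "\<dots> = K\<^sup>2 / (2 * \<beta>) + \<beta> / 2 * (norm u)\<^sup>2 - K * norm u"
      using \<beta> by (simp add: power2_eq_square field_simps)
    finally show "norm (exp (K * norm u - \<beta> * (norm u)\<^sup>2))
      \<le> norm (exp (K\<^sup>2 / (2 * \<beta>)) * exp (- (\<beta> / 2) * (norm u)\<^sup>2))"
      by (simp add: exp_add[symmetric])
  qed
qed simp

lemma integrable_lebesgue_iff_lborel:
  fixes f :: "'a::euclidean_space \<Rightarrow> 'b::{banach,second_countable_topology}"
  assumes "f \<in> borel_measurable borel"
  shows "integrable lebesgue f \<longleftrightarrow> integrable lborel f"
    and "integral\<^sup>L lebesgue f = integral\<^sup>L lborel f"
  using assms by (simp_all add: integrable_completion integral_completion)

lemma Fock_iff: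
  assumes "\<alpha> > 0"
  shows "h \<in> Fock \<alpha> \<longleftrightarrow> h holomorphic_on UNIV \<and> integrable lborel (\<lambda>z. exp (- \<alpha> * (norm z)\<^sup>2) * (norm (h z))\<^sup>2)"
proof (cases "h holomorphic_on UNIV")
  case True
  note [measurable] = borel_measurable_entire[OF True]
  have mm: "(\<lambda>z. (norm (h z))\<^sup>2) \<in> borel_measurable lebesgue"
    "(\<lambda>z::complex. \<alpha> / pi * exp (- \<alpha> * (norm z)\<^sup>2)) \<in> borel_measurable lebesgue"
    by (intro borel_measurable_lebesgueI; measurable)+
  have "integrable (gauss_measure \<alpha>) (\<lambda>z. (norm (h z))\<^sup>2)
     \<longleftrightarrow> integrable lebesgue (\<lambda>z. (\<alpha> / pi * exp (- \<alpha> * (norm z)\<^sup>2)) *\<^sub>R (norm (h z))\<^sup>2)"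
    unfolding gauss_measure_def using assms by (intro integrable_density mm) auto
  also have "\<dots> \<longleftrightarrow> integrable lborel (\<lambda>z. (\<alpha> / pi) * (exp (- \<alpha> * (norm z)\<^sup>2) * (norm (h z))\<^sup>2))"
    by (subst integrable_lebesgue_iff_lborel) (simp_all add: mult.assoc)
  also have "\<dots> \<longleftrightarrow> integrable lborel (\<lambda>z. exp (- \<alpha> * (norm z)\<^sup>2) * (norm (h z))\<^sup>2)"
    using assms by (subst integrable_mult_left_iff) simp
  finally show ?thesis using True by (simp add: Fock_def)
qed (simp add: Fock_def)

lemma Fock_if_exponential_growth:
  assumes "\<alpha> > 0" "h holomorphic_on UNIV" "\<And>u. norm (h u) \<le> B * exp (K * norm u)"
  shows "h \<in> Fock \<alpha>"
proof -
  note [measurable] = borel_measurable_entire[OF assms(2)]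
  have "integrable lborel (\<lambda>z. exp (- \<alpha> * (norm z)\<^sup>2) * (norm (h z))\<^sup>2)"
  proof (rule Bochner_Integration.integrable_bound)
    show "integrable lborel (\<lambda>u::complex. B\<^sup>2 * exp ((2 * K) * norm u - \<alpha> * (norm u)\<^sup>2))"
      by (intro integrable_mult_right integrable_gaussian_exp assms)
    show "AE z in lborel. norm (exp (- \<alpha> * (norm z)\<^sup>2) * (norm (h z))\<^sup>2) \<le>
           norm (B\<^sup>2 * exp ((2 * K) * norm z - \<alpha> * (norm z)\<^sup>2))"
    proof (rule AE_I2)
      fix z
      have "(norm (h z))\<^sup>2 \<le> (B * exp (K * norm z))\<^sup>2"
        using assms(3) by (intro power_mono) auto
      then have "exp (- \<alpha> * (norm z)\<^sup>2) * (norm (h z))\<^sup>2 \<le> exp (- \<alpha> * (norm z)\<^sup>2) * (B\<^sup>2 * exp (2 * K * norm z))"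
        by (intro mult_left_mono) (auto simp: power_mult_distrib exp_double[symmetric] mult.assoc)
      also have "\<dots> = B\<^sup>2 * exp ((2 * K) * norm z - \<alpha> * (norm z)\<^sup>2)"
        by (simp add: exp_diff exp_minus field_simps)
      finally show "norm (exp (- \<alpha> * (norm z)\<^sup>2) * (norm (h z))\<^sup>2) \<le>
           norm (B\<^sup>2 * exp ((2 * K) * norm z - \<alpha> * (norm z)\<^sup>2))" by simp
    qed
  qed measurable
  then show ?thesis using assms by (simp add: Fock_iff)
qed

lemma exp_in_Fock: "\<alpha> > 0 \<Longrightarrow> (\<lambda>u. exp (a * u)) \<in> Fock \<alpha>"
proof (rule Fock_if_exponential_growth[of _ _ 1 "norm a"])
  show "norm (exp (a * u)) \<le> 1 * exp (norm a * norm u)" for u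
    using norm_exp[of "a * u"] by (simp add: norm_mult)
qed (auto intro!: holomorphic_intros)

lemma power_in_Fock: "\<alpha> > 0 \<Longrightarrow> (\<lambda>u. (u - p) ^ n) \<in> Fock \<alpha>"
proof (rule Fock_if_exponential_growth[of _ _ "fact n * exp (norm p)" 1])
  show "norm ((u - p) ^ n) \<le> fact n * exp (norm p) * exp (1 * norm u)" for u
  proof -
    have "norm ((u - p) ^ n) \<le> fact n * exp (norm (u - p))"
      by (simp add: norm_power power_le_fact_mult_exp)
    also have "\<dots> \<le> fact n * exp (norm u + norm p)"
      by (intro mult_left_mono) (auto simp: norm_triangle_ineq4)
    finally show ?thesis by (simp add: exp_add mult_ac)
  qed
qed (auto intro!: holomorphic_intros)

text \<open>
  The bound \<open>x y \<le> x\<^sup>2 + y\<^sup>2\<close> with \<open>x = exp (K |u|)\<close> and \<open>y = |h u|\<close> reduces this to square integrability of both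
  factors against the Gaussian.
\<close>

lemma Fock_integrable_exp:
  assumes "\<alpha> > 0" "h \<in> Fock \<alpha>"
  shows "integrable lborel (\<lambda>u. exp (K * norm u - \<alpha> * (norm u)\<^sup>2) * norm (h u))"
proof -
  have h: "h holomorphic_on UNIV" "integrable lborel (\<lambda>z. exp (- \<alpha> * (norm z)\<^sup>2) * (norm (h z))\<^sup>2)"
    using assms by (auto simp: Fock_iff)
  note [measurable] = borel_measurable_entire[OF h(1)]
  show ?thesis
  proof (rule Bochner_Integration.integrable_bound)
    show "integrable lborel (\<lambda>u. exp ((2 * K) * norm u - \<alpha> * (norm u)\<^sup>2) + exp (- \<alpha> * (norm u)\<^sup>2) * (norm (h u))\<^sup>2)"
      by (intro Bochner_Integration.integrable_add integrable_gaussian_exp assms h)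
    show "AE u in lborel. norm (exp (K * norm u - \<alpha> * (norm u)\<^sup>2) * norm (h u)) \<le>
       norm (exp ((2 * K) * norm u - \<alpha> * (norm u)\<^sup>2) + exp (- \<alpha> * (norm u)\<^sup>2) * (norm (h u))\<^sup>2)"
    proof (rule AE_I2)
      fix u
      let ?x = "exp (K * norm u)" and ?y = "norm (h u)" and ?e = "exp (- \<alpha> * (norm u)\<^sup>2)"
      have "?x * ?y \<le> ?x\<^sup>2 + ?y\<^sup>2"
        using sum_squares_bound[of ?x ?y] mult_nonneg_nonneg[of ?x ?y] unfolding mult.assoc by (simp del: mult_nonneg_nonneg)
      then have "?e * (?x * ?y) \<le> ?e * (?x\<^sup>2 + ?y\<^sup>2)" by (intro mult_left_mono) auto
      also have "\<dots> = exp ((2 * K) * norm u - \<alpha> * (norm u)\<^sup>2) + ?e * ?y\<^sup>2"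
        by (simp add: exp_double[symmetric] exp_diff exp_minus field_simps)
      finally show "norm (exp (K * norm u - \<alpha> * (norm u)\<^sup>2) * norm (h u)) \<le>
         norm (exp ((2 * K) * norm u - \<alpha> * (norm u)\<^sup>2) + exp (- \<alpha> * (norm u)\<^sup>2) * (norm (h u))\<^sup>2)"
        by (simp add: exp_diff exp_minus field_simps)
    qed
  qed measurable
qed

lemma Linf_bound:
  assumes "f \<in> Linf"
  obtains C where "C \<ge> 0" "AE u in lebesgue. norm (f u) \<le> C"
proof -
  from assms obtain C where C: "AE u in lebesgue. norm (f u) \<le> C" by (auto simp: Linf_def)
  then have "AE u in lebesgue. norm (f u) \<le> max 0 C" by eventually_elim simp
  then show ?thesis using that[of "max 0 C"] by simp
qed

lemma integrable_Linf_mult: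
  assumes f: "f \<in> Linf" and k: "integrable lebesgue k"
  shows "integrable lebesgue (\<lambda>u. f u * k u)"
proof -
  from Linf_bound[OF f] obtain C where C: "C \<ge> 0" "AE u in lebesgue. norm (f u) \<le> C" by blast
  show ?thesis
  proof (rule Bochner_Integration.integrable_bound)
    show "integrable lebesgue (\<lambda>u. C * norm (k u))" using k by simp
    show "(\<lambda>u. f u * k u) \<in> borel_measurable lebesgue"
      using f k by (intro borel_measurable_times) (auto simp: Linf_def)
    show "AE u in lebesgue. norm (f u * k u) \<le> norm (C * norm (k u))"
      using C(2) by eventually_elim (use C(1) in \<open>simp add: norm_mult mult_right_mono\<close>)
  qed
qed

lemma norm_integral_Linf_le:
  fixes f k :: "complex \<Rightarrow> complex" and K :: "complex \<Rightarrow> real"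
  assumes f: "f \<in> borel_measurable lebesgue" and C: "AE u in lebesgue. norm (f u) \<le> C" "C \<ge> 0"
    and k: "k \<in> borel_measurable borel" and K: "integrable lborel K" "\<And>u. norm (k u) \<le> K u"
  shows "norm (LINT u|lebesgue. f u * k u) \<le> C * (LINT u|lborel. K u)"
proof -
  have fl: "f \<in> Linf" using f C by (auto simp: Linf_def)
  have kl: "integrable lebesgue k"
    using k K by (subst integrable_lebesgue_iff_lborel)
     (auto intro!: Bochner_Integration.integrable_bound[OF K(1)] AE_I2 order_trans[OF _ abs_ge_self])
  have Kl: "integrable lebesgue K" "integral\<^sup>L lebesgue K = integral\<^sup>L lborel K"
    using K by (simp_all add: integrable_completion integral_completion)
  have "norm (LINT u|lebesgue. f u * k u) \<le> (LINT u|lebesgue. norm (f u * k u))"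
    by (rule integral_norm_bound)
  also have "\<dots> \<le> (LINT u|lebesgue. C * K u)"
  proof (rule integral_mono_AE)
    show "integrable lebesgue (\<lambda>u. norm (f u * k u))"
      by (intro integrable_norm integrable_Linf_mult fl kl)
    show "AE u in lebesgue. norm (f u * k u) \<le> C * K u"
      using C(1) by eventually_elim (use C(2) K(2) in \<open>auto simp: norm_mult intro!: mult_mono\<close>)
  qed (use Kl in simp)
  also have "\<dots> = C * (LINT u|lborel. K u)" using Kl by simp
  finally show ?thesis .
qed

text \<open>
  The Fock reproducing kernel \<open>exp (\<alpha> z cnj u)\<close> multiplied by the Gaussian density, up to the constant \<open>\<alpha>/\<pi>\<close>.
\<close>

definition toeplitz_kernel :: "real \<Rightarrow> complex \<Rightarrow> complex \<Rightarrow> complex" where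
  "toeplitz_kernel \<alpha> z u = exp (of_real \<alpha> * z * cnj u - of_real (\<alpha> * (norm u)\<^sup>2))"

lemma toeplitz_kernel_measurable [measurable]: "toeplitz_kernel \<alpha> z \<in> borel_measurable borel"
  unfolding toeplitz_kernel_def by measurable

lemma norm_toeplitz_kernel_le:
  assumes "\<alpha> > 0"
  shows "norm (toeplitz_kernel \<alpha> z u) \<le> exp (\<alpha> * norm z * norm u - \<alpha> * (norm u)\<^sup>2)"
proof -
  have "Re (z * cnj u) \<le> norm z * norm u"
    using complex_Re_le_cmod[of "z * cnj u"] by (simp add: norm_mult)
  then have "\<alpha> * Re (z * cnj u) \<le> \<alpha> * (norm z * norm u)" using assms by simp
  then show ?thesis by (simp add: toeplitz_kernel_def algebra_simps)
qed

lemma Fock_kernel_integrable: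
  assumes "\<alpha> > 0" "h \<in> Fock \<alpha>"
  shows "integrable lebesgue (\<lambda>u. cnj u ^ n * (h u * toeplitz_kernel \<alpha> z u))"
proof -
  have h: "h holomorphic_on UNIV" using assms by (simp add: Fock_def)
  note [measurable] = borel_measurable_entire[OF h]
  have "integrable lborel (\<lambda>u. cnj u ^ n * (h u * toeplitz_kernel \<alpha> z u))"
  proof (rule Bochner_Integration.integrable_bound)
    show "integrable lborel (\<lambda>u. fact n * (exp ((\<alpha> * norm z + 1) * norm u - \<alpha> * (norm u)\<^sup>2) * norm (h u)))"
      by (intro integrable_mult_right Fock_integrable_exp assms)
    show "AE u in lborel. norm (cnj u ^ n * (h u * toeplitz_kernel \<alpha> z u)) \<le>
        norm (fact n * (exp ((\<alpha> * norm z + 1) * norm u - \<alpha> * (norm u)\<^sup>2) * norm (h u)))"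
    proof (rule AE_I2)
      fix u
      have "norm (cnj u ^ n * (h u * toeplitz_kernel \<alpha> z u))
         \<le> (fact n * exp (norm u)) * (norm (h u) * exp (\<alpha> * norm z * norm u - \<alpha> * (norm u)\<^sup>2))"
        unfolding norm_mult norm_power complex_mod_cnj
        by (intro mult_mono power_le_fact_mult_exp norm_toeplitz_kernel_le assms) auto
      also have "\<dots> = fact n * (exp ((\<alpha> * norm z + 1) * norm u - \<alpha> * (norm u)\<^sup>2) * norm (h u))"
        by (simp add: exp_add exp_diff algebra_simps)
      finally show "norm (cnj u ^ n * (h u * toeplitz_kernel \<alpha> z u)) \<le>
        norm (fact n * (exp ((\<alpha> * norm z + 1) * norm u - \<alpha> * (norm u)\<^sup>2) * norm (h u)))" by simp
    qed
  qed measurable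
  then show ?thesis by (subst integrable_lebesgue_iff_lborel) auto
qed

lemma toeplitz_eq_kernel:
  "toeplitz \<alpha> f h z = of_real (\<alpha> / pi) * (LINT u|lebesgue. f u * (h u * toeplitz_kernel \<alpha> z u))"
  by (simp add: toeplitz_def toeplitz_kernel_def mult.assoc)

lemma exp_gt_self: "(x::real) < exp x"
  using exp_ge_add_one_self[of x] by linarith

lemma norm_exp_minus_one_le: "norm (exp (a::complex) - 1) \<le> norm a * exp (norm a)"
proof -
  have "norm (exp a - (\<Sum>k\<le>0. a ^ k / fact k)) \<le> exp \<bar>Re a\<bar> * (norm a ^ Suc 0) / fact 0"
    by (rule Taylor_exp)
  also have "\<dots> \<le> norm a * exp (norm a)"
    using abs_Re_le_cmod[of a] by (simp add: mult.commute mult_left_mono)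
  finally show ?thesis by simp
qed

text \<open>
  The Volterra side is already known to be differentiable, so difference quotients along one sequence suffice, and for
  these the dominated convergence theorem applies directly.
\<close>

lemma toeplitz_has_derivative_sequence:
  assumes \<alpha>: "\<alpha> > 0" and f: "f \<in> Linf" and h: "h \<in> Fock \<alpha>"
  shows "(\<lambda>n. (toeplitz \<alpha> f h (z + of_real (inverse (Suc n))) - toeplitz \<alpha> f h z) / of_real (inverse (Suc n)))
     \<longlonglongrightarrow> of_real (\<alpha>\<^sup>2 / pi) * (LINT u|lebesgue. f u * (cnj u * (h u * toeplitz_kernel \<alpha> z u)))"
proof -
  define d where "d n = complex_of_real (inverse (Suc n))" for n
  have d0: "d n \<noteq> 0" for n by (simp add: d_def del: of_nat_Suc)
  have dlim: "d \<longlonglongrightarrow> 0" unfolding d_def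
    using tendsto_of_real[OF LIMSEQ_inverse_real_of_nat, where 'a=complex] by simp
  have dle: "norm (d n) \<le> 1" for n by (simp add: d_def norm_inverse inverse_le_1_iff del: of_real_inverse of_nat_Suc)
  define k where "k u = h u * toeplitz_kernel \<alpha> z u" for u
  define Q where "Q n u = (exp (of_real \<alpha> * d n * cnj u) - 1) / d n" for n u
  have hol: "h holomorphic_on UNIV" using h by (simp add: Fock_def)
  note [measurable] = borel_measurable_entire[OF hol]
  have km: "k \<in> borel_measurable borel" unfolding k_def by measurable
  have kint: "integrable lebesgue (\<lambda>u. f u * (h u * toeplitz_kernel \<alpha> w u))" for w
    using Fock_kernel_integrable[OF \<alpha> h, of 0 w] by (intro integrable_Linf_mult[OF f]) simp
  have quot: "(toeplitz \<alpha> f h (z + d n) - toeplitz \<alpha> f h z) / d n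
      = of_real (\<alpha> / pi) * (LINT u|lebesgue. f u * (Q n u * k u))" for n
  proof -
    have "toeplitz \<alpha> f h (z + d n) - toeplitz \<alpha> f h z
       = of_real (\<alpha> / pi) * (LINT u|lebesgue. f u * (h u * toeplitz_kernel \<alpha> (z + d n) u) - f u * (h u * toeplitz_kernel \<alpha> z u))"
      unfolding toeplitz_eq_kernel by (simp add: kint right_diff_distrib)
    also have "(\<lambda>u. f u * (h u * toeplitz_kernel \<alpha> (z + d n) u) - f u * (h u * toeplitz_kernel \<alpha> z u))
        = (\<lambda>u. d n * (f u * (Q n u * k u)))"
    proof
      fix u
      have "toeplitz_kernel \<alpha> (z + d n) u = exp (of_real \<alpha> * d n * cnj u) * toeplitz_kernel \<alpha> z u"
        unfolding toeplitz_kernel_def exp_add[symmetric] by (simp add: algebra_simps)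
      moreover have "d n * Q n u = exp (of_real \<alpha> * d n * cnj u) - 1"
        using d0[of n] by (simp add: Q_def)
      then have "d n * (f u * (Q n u * k u)) = f u * ((exp (of_real \<alpha> * d n * cnj u) - 1) * k u)"
        by (metis mult.assoc mult.left_commute)
      ultimately show "f u * (h u * toeplitz_kernel \<alpha> (z + d n) u) - f u * (h u * toeplitz_kernel \<alpha> z u) = d n * (f u * (Q n u * k u))"
        by (simp add: k_def algebra_simps)
    qed
    finally show ?thesis using d0[of n] by simp
  qed
  have "(\<lambda>n. LINT u|lebesgue. f u * (Q n u * k u)) \<longlonglongrightarrow> (LINT u|lebesgue. f u * ((of_real \<alpha> * cnj u) * k u))"
  proof (rule integral_dominated_convergence)
    have [measurable]: "f \<in> borel_measurable lebesgue" using f by (simp add: Linf_def)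
    have [measurable]: "k \<in> borel_measurable lebesgue" by (intro borel_measurable_lebesgueI km)
    have [measurable]: "Q n \<in> borel_measurable lebesgue" for n
      unfolding Q_def by (intro borel_measurable_lebesgueI) measurable
    have [measurable]: "(\<lambda>u. of_real \<alpha> * cnj u) \<in> borel_measurable lebesgue"
      by (intro borel_measurable_lebesgueI) measurable
    show "(\<lambda>u. f u * ((of_real \<alpha> * cnj u) * k u)) \<in> borel_measurable lebesgue" by measurable
    show "(\<lambda>u. f u * (Q n u * k u)) \<in> borel_measurable lebesgue" for n by measurable
    show "AE u in lebesgue. (\<lambda>n. f u * (Q n u * k u)) \<longlonglongrightarrow> f u * ((of_real \<alpha> * cnj u) * k u)"
    proof (intro AE_I2 tendsto_intros)
      fix u
      have "((\<lambda>t. exp (of_real \<alpha> * t * cnj u)) has_field_derivative of_real \<alpha> * cnj u) (at 0)"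
        by (auto intro!: derivative_eq_intros)
      then have "((\<lambda>t. (exp (of_real \<alpha> * t * cnj u) - 1) / t) \<longlongrightarrow> of_real \<alpha> * cnj u) (at 0)"
        by (simp add: DERIV_def)
      moreover have "filterlim d (at 0) sequentially"
        using dlim d0 by (simp add: filterlim_at)
      ultimately show "(\<lambda>n. Q n u) \<longlonglongrightarrow> of_real \<alpha> * cnj u"
        unfolding Q_def by (rule filterlim_compose)
    qed
    let ?w = "\<lambda>u. norm (f u * of_real (exp ((\<alpha> * norm z + \<alpha> + 1) * norm u - \<alpha> * (norm u)\<^sup>2) * norm (h u))) * \<alpha>"
    have "integrable lebesgue (\<lambda>u. complex_of_real (exp ((\<alpha> * norm z + \<alpha> + 1) * norm u - \<alpha> * (norm u)\<^sup>2) * norm (h u)))"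
      using Fock_integrable_exp[OF \<alpha> h, of "\<alpha> * norm z + \<alpha> + 1"]
      by (subst integrable_lebesgue_iff_lborel) (auto intro!: integrable_of_real simp del: of_real_mult)
    then show "integrable lebesgue ?w"
      by (intro integrable_mult_left integrable_norm integrable_Linf_mult f)
    show "AE u in lebesgue. norm (f u * (Q n u * k u)) \<le> ?w u" for n
    proof (rule AE_I2)
      fix u
      have "norm (exp (of_real \<alpha> * d n * cnj u) - 1) \<le> norm (of_real \<alpha> * d n * cnj u) * exp (norm (of_real \<alpha> * d n * cnj u))"
        by (rule norm_exp_minus_one_le)
      also have "\<dots> \<le> norm (of_real \<alpha> * d n * cnj u) * exp (\<alpha> * norm u)"
        using \<alpha> dle[of n] by (intro mult_left_mono) (auto simp: norm_mult mult_left_le_one_le mult.assoc intro!: mult_left_mono)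
      finally have "norm (Q n u) \<le> \<alpha> * norm u * exp (\<alpha> * norm u)"
        using d0[of n] \<alpha> by (simp add: Q_def norm_divide norm_mult field_simps)
      also have "\<dots> \<le> \<alpha> * exp (norm u) * exp (\<alpha> * norm u)"
        using \<alpha> less_imp_le[OF exp_gt_self[of "norm u"]] by (intro mult_right_mono mult_left_mono) auto
      finally have "norm (Q n u) * norm (k u) \<le> (\<alpha> * exp (norm u) * exp (\<alpha> * norm u)) * (norm (h u) * exp (\<alpha> * norm z * norm u - \<alpha> * (norm u)\<^sup>2))"
        unfolding k_def norm_mult using \<alpha> by (intro mult_mono norm_toeplitz_kernel_le) auto
      also have "\<dots> = exp ((\<alpha> * norm z + \<alpha> + 1) * norm u - \<alpha> * (norm u)\<^sup>2) * norm (h u) * \<alpha>"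
        by (simp add: exp_add exp_diff algebra_simps)
      finally have "norm (f u) * (norm (Q n u) * norm (k u)) \<le> norm (f u) * (exp ((\<alpha> * norm z + \<alpha> + 1) * norm u - \<alpha> * (norm u)\<^sup>2) * norm (h u) * \<alpha>)"
        by (intro mult_left_mono) auto
      then show "norm (f u * (Q n u * k u)) \<le> ?w u"
        by (simp add: norm_mult)
    qed
  qed
  then have "(\<lambda>n. of_real (\<alpha> / pi) * (LINT u|lebesgue. f u * (Q n u * k u)))
      \<longlonglongrightarrow> of_real (\<alpha> / pi) * (LINT u|lebesgue. f u * ((of_real \<alpha> * cnj u) * k u))"
    by (intro tendsto_intros)
  also have "(LINT u|lebesgue. f u * ((of_real \<alpha> * cnj u) * k u)) = of_real \<alpha> * (LINT u|lebesgue. f u * (cnj u * k u))"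
    by (subst integral_mult_right_zero[symmetric]) (simp add: mult_ac)
  finally show ?thesis
    unfolding quot[symmetric] by (simp add: d_def k_def power2_eq_square mult_ac)
qed

text \<open>
  This identity is the source of all necessary conditions: its left-hand side is a product, with no integration left.
\<close>

lemma volterra_eq_toeplitz_derivative:
  assumes \<alpha>: "\<alpha> > 0" and f: "f \<in> Linf" and g: "g holomorphic_on UNIV" and \<phi>: "\<phi> holomorphic_on UNIV"
    and eq: "volterra_eq_toeplitz \<alpha> g \<phi> f" and h: "h \<in> Fock \<alpha>"
  shows "h (\<phi> z) * deriv g z = of_real (\<alpha>\<^sup>2 / pi) * (LINT u|lebesgue. f u * (cnj u * (h u * toeplitz_kernel \<alpha> z u)))"
proof -
  have hol: "h holomorphic_on UNIV" using h by (simp add: Fock_def)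
  have "toeplitz \<alpha> f h = volterra g \<phi> h" using eq h by (simp add: volterra_eq_toeplitz_def)
  then have "(toeplitz \<alpha> f h has_field_derivative h (\<phi> z) * deriv g z) (at z)"
    using volterra_has_field_derivative[OF g \<phi> hol] by simp
  then have "((\<lambda>t. (toeplitz \<alpha> f h (z + t) - toeplitz \<alpha> f h z) / t) \<longlongrightarrow> h (\<phi> z) * deriv g z) (at 0)"
    by (simp add: DERIV_def)
  moreover have "filterlim (\<lambda>n. complex_of_real (inverse (Suc n))) (at 0) sequentially"
    using tendsto_of_real[OF LIMSEQ_inverse_real_of_nat, where 'a=complex]
    by (simp add: filterlim_at del: of_nat_Suc)
  ultimately have "(\<lambda>n. (toeplitz \<alpha> f h (z + of_real (inverse (Suc n))) - toeplitz \<alpha> f h z) / of_real (inverse (Suc n)))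
     \<longlonglongrightarrow> h (\<phi> z) * deriv g z"
    by (rule filterlim_compose)
  then show ?thesis
    using toeplitz_has_derivative_sequence[OF \<alpha> f h] by (rule LIMSEQ_unique)
qed

section \<open>Growth of the multiplier and linearity of the composition symbol\<close>
text \<open>
  With \<open>a = s - \<alpha> cnj z\<close> the exponent \<open>a u + \<alpha> z cnj u\<close> differs from \<open>s u\<close> by an imaginary number, so \<open>z\<close> disappears
  from the modulus. All exponentials below are chosen in this form.
\<close>

lemma norm_exp_mult_kernel:
  "norm (exp ((s - of_real \<alpha> * cnj z) * u) * toeplitz_kernel \<alpha> z u) = exp (Re (s * u) - \<alpha> * (norm u)\<^sup>2)"
  unfolding toeplitz_kernel_def exp_add[symmetric] norm_exp_eq_Re
  by (simp add: algebra_simps)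

lemma dense_nonzeros:
  assumes k: "k holomorphic_on UNIV" and nz: "k z1 \<noteq> (0::complex)"
  shows "closure {z. k z \<noteq> 0} = UNIV"
proof (rule ccontr)
  assume "closure {z. k z \<noteq> 0} \<noteq> UNIV"
  have "k z1 = 0"
  proof (rule analytic_continuation_open[where s="- closure {z. k z \<noteq> 0}" and s'=UNIV and f=k and g="\<lambda>_. 0"])
    show "- closure {z. k z \<noteq> 0} \<noteq> {}" using \<open>closure _ \<noteq> UNIV\<close> by blast
    show "k z = 0" if "z \<in> - closure {z. k z \<noteq> 0}" for z
      using that closure_subset[of "{z. k z \<noteq> 0}"] by blast
  qed (use k in auto)
  with nz show False ..
qed

locale volterra_toeplitz =
  fixes \<alpha> :: real and g \<phi> f :: "complex \<Rightarrow> complex"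
  assumes alpha: "\<alpha> > 0" and g: "g holomorphic_on UNIV" and phi: "\<phi> holomorphic_on UNIV"
    and f: "f \<in> Linf" and eq: "volterra_eq_toeplitz \<alpha> g \<phi> f"
begin

lemma g': "deriv g holomorphic_on UNIV"
  using g by (intro holomorphic_deriv) auto

lemmas derivative_identity = volterra_eq_toeplitz_derivative[OF alpha f g phi eq]

text \<open>
  Put \<open>p = \<phi> z\<close> and \<open>a = 2 \<alpha> cnj p - \<alpha> cnj z\<close>. Then the integrand in \<open>derivative_identity\<close> for \<open>exp (a u)\<close> is bounded
  by \<open>exp (\<alpha> |p|\<^sup>2)\<close> times a Gaussian centred at \<open>p\<close>, whereas the left-hand side has modulus
  \<open>exp (2 \<alpha> |p|\<^sup>2 - \<alpha> Re (cnj z p)) |g' z|\<close>. Among all \<open>a\<close> this one gives the best exponent.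
\<close>

lemma deriv_growth:
  obtains A where "A \<ge> 0"
    "\<And>z. norm (deriv g z) \<le> A * (1 + norm (\<phi> z)) * exp (\<alpha> * (Re (cnj z * \<phi> z) - (norm (\<phi> z))\<^sup>2))"
proof -
  from Linf_bound[OF f] obtain C where C: "C \<ge> 0" "AE u in lebesgue. norm (f u) \<le> C" by blast
  define M1 where "M1 = (LINT u|lborel. norm (u::complex) * exp (- \<alpha> * (norm u)\<^sup>2))"
  define M0 where "M0 = (LINT u::complex|lborel. exp (- \<alpha> * (norm u)\<^sup>2))"
  have M: "M1 \<ge> 0" "M0 \<ge> 0" by (simp_all add: M1_def M0_def)
  have i0: "integrable lborel (\<lambda>u::complex. exp (- \<alpha> * (norm u)\<^sup>2))"
    using integrable_gaussian_exp[OF alpha, of 0] by simp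
  have i1: "integrable lborel (\<lambda>u::complex. norm u * exp (- \<alpha> * (norm u)\<^sup>2))"
  proof (rule Bochner_Integration.integrable_bound)
    show "integrable lborel (\<lambda>u::complex. exp (1 * norm u - \<alpha> * (norm u)\<^sup>2))"
      by (rule integrable_gaussian_exp[OF alpha])
    show "AE u::complex in lborel. norm (norm u * exp (- \<alpha> * (norm u)\<^sup>2)) \<le> norm (exp (1 * norm u - \<alpha> * (norm u)\<^sup>2))"
      using exp_gt_self by (auto simp: exp_diff exp_minus divide_inverse intro!: AE_I2 mult_right_mono less_imp_le)
  qed simp
  define A where "A = \<alpha>\<^sup>2 / pi * C * (M1 + M0)"
  show thesis
  proof (rule that)
    show "A \<ge> 0" unfolding A_def using C M alpha by simp
    fix z
    define p where "p = \<phi> z"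
    define a where "a = of_real (2 * \<alpha>) * cnj p - of_real \<alpha> * cnj z"
    define k where "k u = cnj u * (exp (a * u) * toeplitz_kernel \<alpha> z u)" for u
    define K where "K u = exp (\<alpha> * (norm p)\<^sup>2) * ((norm (- p + u) + norm p) * exp (- \<alpha> * (norm (- p + u))\<^sup>2))" for u
    define K' where "K' v = (norm v + norm p) * exp (- \<alpha> * (norm v)\<^sup>2)" for v :: complex
    have K'm [measurable]: "K' \<in> borel_measurable borel" unfolding K'_def by measurable
    have K'i: "integrable lborel K'" unfolding K'_def distrib_right
      by (intro Bochner_Integration.integrable_add integrable_mult_right i0 i1)
    have K'v: "integral\<^sup>L lborel K' = M1 + norm p * M0" unfolding K'_def distrib_right
      using i0 i1 by (simp add: M1_def M0_def)
    have KK': "K = (\<lambda>u. exp (\<alpha> * (norm p)\<^sup>2) * K' (- p + u))" by (rule ext) (simp add: K_def K'_def)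
    have Ki: "integrable lborel K"
      unfolding KK' using lborel_translate(2)[OF K'm, of "- p"] K'i by (intro integrable_mult_right) simp
    have Kv: "integral\<^sup>L lborel K = exp (\<alpha> * (norm p)\<^sup>2) * (M1 + norm p * M0)"
      unfolding KK' using lborel_translate(1)[OF K'm, of "- p"] K'v by simp
    have kK: "norm (k u) \<le> K u" for u
    proof -
      have "norm (k u) = norm u * exp (Re (of_real (2 * \<alpha>) * cnj p * u) - \<alpha> * (norm u)\<^sup>2)"
        unfolding k_def a_def norm_mult[of "cnj u"] norm_exp_mult_kernel by simp
      also have "Re (of_real (2 * \<alpha>) * cnj p * u) - \<alpha> * (norm u)\<^sup>2 = \<alpha> * (norm p)\<^sup>2 - \<alpha> * (norm (- p + u))\<^sup>2"
        by (simp only: cmod_power2) (simp add: power2_eq_square algebra_simps)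
      also have "norm u * exp (\<alpha> * (norm p)\<^sup>2 - \<alpha> * (norm (- p + u))\<^sup>2)
         \<le> (norm (- p + u) + norm p) * exp (\<alpha> * (norm p)\<^sup>2 - \<alpha> * (norm (- p + u))\<^sup>2)"
        using norm_triangle_ineq[of "- p + u" p] by (intro mult_right_mono) auto
      also have "\<dots> = K u"
        by (simp add: K_def exp_diff exp_minus divide_inverse mult_ac)
      finally show ?thesis .
    qed
    have "norm (LINT u|lebesgue. f u * k u) \<le> C * (LINT u|lborel. K u)"
      using f by (intro norm_integral_Linf_le[OF _ C(2,1) _ Ki kK]) (auto simp: Linf_def k_def)
    also have "\<dots> \<le> C * (exp (\<alpha> * (norm p)\<^sup>2) * ((M1 + M0) * (1 + norm p)))"
      unfolding Kv using M C by (intro mult_left_mono) (auto simp: algebra_simps)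
    finally have 1: "norm (LINT u|lebesgue. f u * k u) \<le> C * (exp (\<alpha> * (norm p)\<^sup>2) * ((M1 + M0) * (1 + norm p)))" .
    have "norm (exp (a * p) * deriv g z) = \<alpha>\<^sup>2 / pi * norm (LINT u|lebesgue. f u * k u)"
      using derivative_identity[OF exp_in_Fock[OF alpha], of a z] by (simp add: p_def k_def norm_mult norm_divide norm_power)
    also have "\<dots> \<le> \<alpha>\<^sup>2 / pi * (C * (exp (\<alpha> * (norm p)\<^sup>2) * ((M1 + M0) * (1 + norm p))))"
      by (intro mult_left_mono 1) auto
    also have "\<dots> = A * (1 + norm p) * exp (\<alpha> * (norm p)\<^sup>2)"
      by (simp add: A_def)
    finally have 2: "exp (Re (a * p)) * norm (deriv g z) \<le> A * (1 + norm p) * exp (\<alpha> * (norm p)\<^sup>2)"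
      by (simp add: norm_mult)
    have "Re (a * p) = 2 * \<alpha> * (norm p)\<^sup>2 - \<alpha> * Re (cnj z * p)"
      unfolding a_def by (simp only: cmod_power2) (simp add: power2_eq_square algebra_simps)
    then have 3: "\<alpha> * (Re (cnj z * p) - (norm p)\<^sup>2) = \<alpha> * (norm p)\<^sup>2 - Re (a * p)"
      by (simp add: algebra_simps)
    have "norm (deriv g z) \<le> A * (1 + norm p) * exp (\<alpha> * (Re (cnj z * p) - (norm p)\<^sup>2))"
      unfolding 3 exp_diff using 2 by (simp add: field_simps)
    then show "norm (deriv g z) \<le> A * (1 + norm (\<phi> z)) * exp (\<alpha> * (Re (cnj z * \<phi> z) - (norm (\<phi> z))\<^sup>2))"
      by (simp add: p_def)
  qed
qed

text \<open>
  The elementary bound \<open>|u - p|\<^sup>2 \<le> (8/\<alpha>) X\<close> with \<open>X = \<alpha> (|u|\<^sup>2 + |p|\<^sup>2)/4\<close>, followed by \<open>X ^ m \<le> m! exp X\<close>, uses up only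
  a quarter of the Gaussian weight. Another quarter absorbs \<open>exp (\<alpha> |w| |u|)\<close>, so half of it remains to make the
  integral finite.
\<close>

lemma power_growth:
  obtains M where "M \<ge> 0"
    "\<And>p w m. norm (\<phi> w - p) ^ (2 * m) * norm (deriv g w)
        \<le> M * (8 / \<alpha>) ^ m * fact m * exp (\<alpha> * ((norm p)\<^sup>2 / 4 + (norm w)\<^sup>2))"
proof -
  from Linf_bound[OF f] obtain C where C: "C \<ge> 0" "AE u in lebesgue. norm (f u) \<le> C" by blast
  define K0 where "K0 u = exp (1 * norm u - (\<alpha> / 2) * (norm u)\<^sup>2)" for u :: complex
  have K0: "integrable lborel K0" unfolding K0_def using alpha by (intro integrable_gaussian_exp) simp
  define M where "M = \<alpha>\<^sup>2 / pi * C * (LINT u|lborel. K0 u)"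
  show thesis
  proof (rule that)
    show "M \<ge> 0" unfolding M_def using C by (auto simp: K0_def intro!: mult_nonneg_nonneg)
    fix p w m
    define k where "k u = cnj u * ((u - p) ^ (2 * m) * toeplitz_kernel \<alpha> w u)" for u
    define B where "B = (8 / \<alpha>) ^ m * fact m * exp (\<alpha> * ((norm p)\<^sup>2 / 4 + (norm w)\<^sup>2))"
    have kK: "norm (k u) \<le> B * K0 u" for u
    proof -
      let ?X = "\<alpha> * ((norm u)\<^sup>2 + (norm p)\<^sup>2) / 4"
      have "(norm (u - p))\<^sup>2 \<le> (norm u + norm p)\<^sup>2"
        by (intro power_mono norm_triangle_ineq4) auto
      also have "\<dots> \<le> 2 * (norm u)\<^sup>2 + 2 * (norm p)\<^sup>2"
        using sum_squares_bound[of "norm u" "norm p"] by (simp add: power2_sum)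
      also have "\<dots> = 8 / \<alpha> * ?X" using alpha by (simp add: field_simps)
      finally have "norm (u - p) ^ (2 * m) \<le> (8 / \<alpha> * ?X) ^ m"
        unfolding power_mult by (intro power_mono) auto
      also have "\<dots> \<le> (8 / \<alpha>) ^ m * (fact m * exp ?X)"
        unfolding power_mult_distrib using alpha by (intro mult_left_mono power_le_fact_mult_exp) auto
      finally have 1: "norm (u - p) ^ (2 * m) \<le> (8 / \<alpha>) ^ m * (fact m * exp ?X)" .
      have "0 \<le> (norm u / 2 - norm w)\<^sup>2" by simp
      then have "norm w * norm u \<le> (norm w)\<^sup>2 + (norm u)\<^sup>2 / 4"
        by (simp add: power2_eq_square algebra_simps)
      then have "\<alpha> * norm w * norm u - \<alpha> * (norm u)\<^sup>2 \<le> \<alpha> * ((norm w)\<^sup>2 + (norm u)\<^sup>2 / 4) - \<alpha> * (norm u)\<^sup>2"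
        using alpha by (simp add: mult.assoc)
      then have 2: "norm (toeplitz_kernel \<alpha> w u) \<le> exp (\<alpha> * ((norm w)\<^sup>2 + (norm u)\<^sup>2 / 4) - \<alpha> * (norm u)\<^sup>2)"
        using norm_toeplitz_kernel_le[OF alpha, of w u] by (meson exp_le_cancel_iff order_trans)
      have "norm (k u) \<le> exp (norm u) * (((8 / \<alpha>) ^ m * (fact m * exp ?X)) * exp (\<alpha> * ((norm w)\<^sup>2 + (norm u)\<^sup>2 / 4) - \<alpha> * (norm u)\<^sup>2))"
        unfolding k_def norm_mult norm_power complex_mod_cnj using alpha
        by (intro mult_mono 1 2 less_imp_le[OF exp_gt_self]) auto
      also have "\<dots> = (8 / \<alpha>) ^ m * fact m * exp (norm u + ?X + (\<alpha> * ((norm w)\<^sup>2 + (norm u)\<^sup>2 / 4) - \<alpha> * (norm u)\<^sup>2))"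
        by (simp only: exp_add mult_ac)
      also have "norm u + ?X + (\<alpha> * ((norm w)\<^sup>2 + (norm u)\<^sup>2 / 4) - \<alpha> * (norm u)\<^sup>2)
          = \<alpha> * ((norm p)\<^sup>2 / 4 + (norm w)\<^sup>2) + (1 * norm u - (\<alpha> / 2) * (norm u)\<^sup>2)"
        by (simp add: field_simps)
      finally show ?thesis by (simp only: B_def K0_def exp_add mult.assoc)
    qed
    have "norm (LINT u|lebesgue. f u * k u) \<le> C * (LINT u|lborel. B * K0 u)"
      using f K0 kK by (intro norm_integral_Linf_le[OF _ C(2,1)]) (auto simp: Linf_def k_def)
    then have 1: "norm (LINT u|lebesgue. f u * k u) \<le> C * (B * (LINT u|lborel. K0 u))" by simp
    have "norm ((\<phi> w - p) ^ (2 * m) * deriv g w) = \<alpha>\<^sup>2 / pi * norm (LINT u|lebesgue. f u * k u)"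
      using derivative_identity[OF power_in_Fock[OF alpha], of w p "2 * m"]
      by (simp add: k_def norm_mult norm_divide norm_power)
    also have "\<dots> \<le> \<alpha>\<^sup>2 / pi * (C * (B * (LINT u|lborel. K0 u)))"
      by (intro mult_left_mono 1) auto
    also have "\<dots> = M * B" by (simp add: M_def)
    finally show "norm (\<phi> w - p) ^ (2 * m) * norm (deriv g w)
        \<le> M * (8 / \<alpha>) ^ m * fact m * exp (\<alpha> * ((norm p)\<^sup>2 / 4 + (norm w)\<^sup>2))"
      by (simp add: B_def norm_mult norm_power mult.assoc)
  qed
qed

text \<open>
  The difference quotient \<open>q\<close> of \<open>\<phi>\<close> at \<open>z0\<close> has value \<open>\<phi>' z0\<close> there, so \<open>q ^ (2 m) g'\<close> can be estimated at \<open>z0\<close>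
  by its values on a circle. On the circle of radius \<open>sqrt m\<close> the factor \<open>m!\<close> of \<open>power_growth\<close> is compensated by
  \<open>|w - z0| ^ (2 m) = m ^ m\<close> and the Gaussian factor is at most a constant times \<open>exp (2 \<alpha> m)\<close>. Taking \<open>m\<close>-th roots removes
  everything that depends on \<open>z0\<close>, including \<open>|g' z0|\<close>.
\<close>

lemma deriv_phi_bound:
  assumes nz: "deriv g z0 \<noteq> 0"
  shows "(norm (deriv \<phi> z0))\<^sup>2 \<le> 8 / \<alpha> * exp (2 * \<alpha>)"
proof (rule ccontr)
  define D where "D = 8 / \<alpha> * exp (2 * \<alpha>)"
  define x where "x = (norm (deriv \<phi> z0))\<^sup>2"
  assume "\<not> ?thesis"
  then have Dx: "D < x" by (simp add: D_def x_def)
  have D: "D > 0" using alpha by (simp add: D_def)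
  obtain M where M: "M \<ge> 0" "\<And>p w m. norm (\<phi> w - p) ^ (2 * m) * norm (deriv g w)
        \<le> M * (8 / \<alpha>) ^ m * fact m * exp (\<alpha> * ((norm p)\<^sup>2 / 4 + (norm w)\<^sup>2))"
    using power_growth by blast
  define M' where "M' = M * exp (\<alpha> * ((norm (\<phi> z0))\<^sup>2 / 4 + 2 * (norm z0)\<^sup>2))"
  define q where "q w = (if w = z0 then deriv \<phi> z0 else (\<phi> w - \<phi> z0) / (w - z0))" for w
  have q: "q holomorphic_on UNIV"
    unfolding q_def by (rule pole_lemma_open[OF phi]) simp
  have key: "x ^ m * norm (deriv g z0) \<le> M' * D ^ m" if m: "m \<ge> 1" for m
  proof -
    let ?Q = "\<lambda>w. q w ^ (2 * m) * deriv g w"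
    have Q: "?Q holomorphic_on UNIV" by (intro holomorphic_intros q g')
    \<comment> \<open>the Cauchy inequality of order \<open>0\<close> is the maximum principle on the circle\<close>
    have "norm ((deriv ^^ 0) ?Q z0) \<le> fact 0 * (M' * D ^ m) / sqrt m ^ 0"
    proof (rule Cauchy_inequality)
      show "?Q holomorphic_on ball z0 (sqrt m)" using Q by (rule holomorphic_on_subset) simp
      show "continuous_on (cball z0 (sqrt m)) ?Q"
        using holomorphic_on_imp_continuous_on[OF Q] continuous_on_subset by blast
      show "0 < sqrt m" using m by simp
      fix w assume w: "norm (z0 - w) = sqrt m"
      then have wn: "w \<noteq> z0" using m by auto
      have "norm (w - z0) = sqrt m" using w by (simp add: norm_minus_commute)
      then have wm: "norm (w - z0) ^ (2 * m) = real m ^ m"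
        by (simp add: power_mult)
      have "norm w \<le> norm z0 + sqrt m"
        using norm_triangle_ineq2[of w z0] w by (simp add: norm_minus_commute)
      then have "(norm w)\<^sup>2 \<le> (norm z0 + sqrt m)\<^sup>2" by (intro power_mono) auto
      also have "\<dots> \<le> 2 * (norm z0)\<^sup>2 + 2 * real m"
        using sum_squares_bound[of "norm z0" "sqrt m"] by (simp add: power2_sum)
      finally have w2: "(norm w)\<^sup>2 \<le> 2 * (norm z0)\<^sup>2 + 2 * real m" .
      have "norm (?Q w) * real m ^ m = norm (\<phi> w - \<phi> z0) ^ (2 * m) * norm (deriv g w)"
        using wn m unfolding wm[symmetric] by (simp add: q_def norm_mult norm_power norm_divide power_divide)
      also have "\<dots> \<le> M * (8 / \<alpha>) ^ m * fact m * exp (\<alpha> * ((norm (\<phi> z0))\<^sup>2 / 4 + (norm w)\<^sup>2))"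
        by (rule M)
      also have "\<dots> \<le> M * (8 / \<alpha>) ^ m * real m ^ m * exp (\<alpha> * ((norm (\<phi> z0))\<^sup>2 / 4 + (2 * (norm z0)\<^sup>2 + 2 * real m)))"
        using M(1) alpha w2 fact_le_power[of m, where 'a=real] by (intro mult_mono mult_left_mono) auto
      also have "\<dots> = M' * D ^ m * real m ^ m"
        by (simp add: M'_def D_def power_mult_distrib power_divide exp_of_nat_mult[symmetric] exp_add[symmetric] algebra_simps)
      finally show "norm (?Q w) \<le> M' * D ^ m"
        using m by simp
    qed
    then show ?thesis
      by (simp add: q_def x_def norm_mult norm_power power_mult)
  qed
  have "1 < x / D" using Dx D by simp
  then obtain n where n: "M' / norm (deriv g z0) < (x / D) ^ n"
    using real_arch_pow by blast
  also have "\<dots> \<le> (x / D) ^ Suc n"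
    using \<open>1 < x / D\<close> by (intro power_increasing) auto
  finally have "M' * D ^ Suc n < x ^ Suc n * norm (deriv g z0)"
    using D nz by (simp add: power_divide field_simps)
  with key[of "Suc n"] show False by simp
qed

lemma phi_affine:
  assumes nz: "deriv g z1 \<noteq> 0"
  obtains lam b where "\<And>z. \<phi> z = lam * z + b"
proof -
  have phi': "deriv \<phi> holomorphic_on UNIV"
    using phi by (intro holomorphic_deriv) auto
  have "(norm (deriv \<phi> z))\<^sup>2 \<le> 8 / \<alpha> * exp (2 * \<alpha>)" for z
  proof (rule continuous_le_on_closure[where f="\<lambda>z. (norm (deriv \<phi> z))\<^sup>2" and S="{z. deriv g z \<noteq> 0}"])
    show "continuous_on (closure {z. deriv g z \<noteq> 0}) (\<lambda>z. (norm (deriv \<phi> z))\<^sup>2)"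
      using holomorphic_on_imp_continuous_on[OF phi'] by (intro continuous_intros) (auto intro: continuous_on_subset)
    show "z \<in> closure {z. deriv g z \<noteq> 0}" using dense_nonzeros[OF g' nz] by simp
  qed (use deriv_phi_bound in auto)
  then have "norm (deriv \<phi> z) \<le> sqrt (8 / \<alpha> * exp (2 * \<alpha>))" for z
    by (rule real_le_rsqrt)
  then have "bounded (range (deriv \<phi>))" by (auto simp: bounded_iff)
  then obtain lam where lam: "\<And>z. deriv \<phi> z = lam"
    using Liouville_theorem[OF phi'] by (auto simp: constant_on_def)
  have "((\<lambda>z. \<phi> z - lam * z) has_field_derivative 0) (at z within UNIV)" for z
  proof -
    have "(\<phi> has_field_derivative lam) (at z)"
      using holomorphic_derivI[OF phi] lam by auto
    then show ?thesis by (auto intro!: derivative_eq_intros)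
  qed
  then obtain b where "\<And>z. \<phi> z - lam * z = b"
    using has_field_derivative_zero_constant[of UNIV "\<lambda>z. \<phi> z - lam * z"] by auto
  then show thesis using that[of lam b] by (metis add.commute diff_add_cancel)
qed

text \<open>
  If \<open>\<phi>\<close> is the constant \<open>b\<close>, then \<open>V\<close> maps \<open>exp (a u)\<close> to \<open>exp (a b) (g - g 0)\<close>. For \<open>a = - \<alpha> cnj z\<close> the Toeplitz side
  is bounded, which makes the entire function \<open>exp (- \<alpha> cnj b z) (g z - g 0)\<close> bounded. It is constant by Liouville's
  theorem, and it vanishes at \<open>0\<close>.
\<close>

lemma deriv_zero_if_phi_constant:
  assumes b: "\<And>z. \<phi> z = b"
  shows "deriv g z = 0"
proof -
  from Linf_bound[OF f] obtain C where C: "C \<ge> 0" "AE u in lebesgue. norm (f u) \<le> C" by blast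
  define B where "B = \<alpha> / pi * (C * (LINT u::complex|lborel. exp (- \<alpha> * (norm u)\<^sup>2)))"
  have bound: "norm (exp (- of_real \<alpha> * cnj b * z) * (g z - g 0)) \<le> B" for z
  proof -
    let ?a = "- of_real \<alpha> * cnj z"
    define k where "k u = exp (?a * u) * toeplitz_kernel \<alpha> z u" for u
    have "volterra g \<phi> (\<lambda>u. exp (?a * u)) z = toeplitz \<alpha> f (\<lambda>u. exp (?a * u)) z"
      using eq exp_in_Fock[OF alpha, of ?a] by (simp add: volterra_eq_toeplitz_def)
    moreover have "volterra g \<phi> (\<lambda>u. exp (?a * u)) z = exp (?a * b) * (g z - g 0)"
    proof -
      have "((\<lambda>\<zeta>. deriv g \<zeta>) has_contour_integral (g (pathfinish (linepath 0 z)) - g (pathstart (linepath 0 z)))) (linepath 0 z)"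
        using holomorphic_derivI[OF g open_UNIV]
        by (intro contour_integral_primitive[where S=UNIV] valid_path_linepath) simp_all
      then show ?thesis
        unfolding volterra_def b by (intro contour_integral_unique has_contour_integral_lmul) simp
    qed
    ultimately have *: "exp (?a * b) * (g z - g 0) = of_real (\<alpha> / pi) * (LINT u|lebesgue. f u * k u)"
      by (simp add: toeplitz_eq_kernel k_def)
    have "norm (LINT u|lebesgue. f u * k u) \<le> C * (LINT u::complex|lborel. exp (- \<alpha> * (norm u)\<^sup>2))"
    proof (rule norm_integral_Linf_le[OF _ C(2,1)])
      show "integrable lborel (\<lambda>u::complex. exp (- \<alpha> * (norm u)\<^sup>2))"
        using integrable_gaussian_exp[OF alpha, of 0] by simp
      show "norm (k u) \<le> exp (- \<alpha> * (norm u)\<^sup>2)" for u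
        using norm_exp_mult_kernel[of 0 \<alpha> z u] by (simp add: k_def)
      show "k \<in> borel_measurable borel" unfolding k_def by measurable
    qed (use f in \<open>simp add: Linf_def\<close>)
    then have "norm (exp (?a * b) * (g z - g 0)) \<le> B"
      unfolding * B_def norm_mult norm_of_real using alpha by (intro mult_mono) auto
    moreover have "norm (exp (?a * b)) = norm (exp (- of_real \<alpha> * cnj b * z))"
      unfolding norm_exp_eq_Re by (simp add: algebra_simps)
    ultimately show ?thesis by (simp only: norm_mult)
  qed
  have "(\<lambda>z. exp (- of_real \<alpha> * cnj b * z) * (g z - g 0)) constant_on UNIV"
  proof (rule Liouville_theorem)
    show "(\<lambda>z. exp (- of_real \<alpha> * cnj b * z) * (g z - g 0)) holomorphic_on UNIV"
      by (intro holomorphic_intros g)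
    show "bounded (range (\<lambda>z. exp (- of_real \<alpha> * cnj b * z) * (g z - g 0)))"
      unfolding bounded_iff using bound by blast
  qed
  then obtain c where c: "\<And>z. exp (- of_real \<alpha> * cnj b * z) * (g z - g 0) = c"
    unfolding constant_on_def by blast
  have "c = 0" using c[of 0] by simp
  have "g z = g 0" for z
    using c[of z] \<open>c = 0\<close> by simp
  then obtain d where "g = (\<lambda>_. d)" by blast
  then show ?thesis by simp
qed

end

section \<open>Uniqueness of the symbol\<close>

lemma entire_gaussian_decay_imp_zero:
  assumes k: "k holomorphic_on UNIV" and d: "\<delta> > 0"
    and bound: "\<And>z. norm (k z) \<le> A * exp (K * norm z - \<delta> * (norm z)\<^sup>2)"
  shows "k z = (0::complex)"
proof (rule Liouville_weak_0[OF k])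
  have "((\<lambda>x. A * exp (K * x - \<delta> * x\<^sup>2)) \<longlongrightarrow> 0) at_top"
    using d by real_asymp
  then have "((\<lambda>z::complex. A * exp (K * norm z - \<delta> * (norm z)\<^sup>2)) \<longlongrightarrow> 0) at_infinity"
    by (rule filterlim_compose) (rule filterlim_norm_at_top)
  then show "(k \<longlongrightarrow> 0) at_infinity"
    by (rule Lim_null_comparison[rotated]) (simp add: bound)
qed

lemma entire_compose:
  fixes k l :: "complex \<Rightarrow> complex"
  assumes "k holomorphic_on UNIV" "l holomorphic_on UNIV"
  shows "(\<lambda>u. k (l u)) holomorphic_on UNIV"
  using holomorphic_on_compose[of l UNIV k] assms by (auto simp: o_def intro: holomorphic_on_subset)

lemma AE_le_imp_le_on_open:
  fixes k :: "'a::euclidean_space \<Rightarrow> real"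
  assumes U: "open U" and k: "continuous_on U k" and ae: "AE x in lebesgue. x \<in> U \<longrightarrow> k x \<le> B"
    and x: "x \<in> U"
  shows "k x \<le> B"
proof (rule ccontr)
  assume "\<not> k x \<le> B"
  let ?S = "U \<inter> k -` {B<..}"
  have "open ?S" by (rule continuous_open_preimage[OF k U]) simp
  moreover have "?S \<noteq> {}" using x \<open>\<not> k x \<le> B\<close> by auto
  moreover have "negligible ?S"
  proof -
    obtain N where N: "\<And>x. x \<in> space lebesgue - N \<Longrightarrow> x \<in> U \<longrightarrow> k x \<le> B" "N \<in> null_sets lebesgue"
      using AE_E3[OF ae] by blast
    have "?S \<subseteq> N" using N(1) by force
    then show ?thesis using N(2) by (meson negligible_iff_null_sets negligible_subset)
  qed
  ultimately show False using open_not_negligible by blast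
qed

text \<open>
  The exponent \<open>\<alpha> (z cnj u - cnj z u)\<close> is \<open>2 \<i> \<alpha>\<close> times the imaginary part of \<open>z cnj u\<close>, that is \<open>\<i> (\<xi> \<bullet> u)\<close> with
  \<open>\<xi> = - 2 \<i> \<alpha> z\<close>. As \<open>z\<close> varies, every frequency \<open>\<xi>\<close> occurs.
\<close>

lemma exp_mult_kernel_eq_cis:
  "exp (- of_real \<alpha> * cnj z * u) * toeplitz_kernel \<alpha> z u = cis ((- 2 * \<i> * of_real \<alpha> * z) \<bullet> u) * exp (- of_real (\<alpha> * (norm u)\<^sup>2))"
  unfolding toeplitz_kernel_def cis_conv_exp exp_add[symmetric]
  by (rule arg_cong[where f=exp]) (simp add: complex_eq_iff inner_complex_def algebra_simps)

lemma kernel_transform_injective: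
  assumes \<alpha>: "\<alpha> > 0" and int: "integrable lebesgue (\<lambda>u. G u * exp (- of_real (\<alpha> * (norm u)\<^sup>2)))"
    and zero: "\<And>z. (LINT u|lebesgue. G u * (exp (- of_real \<alpha> * cnj z * u) * toeplitz_kernel \<alpha> z u)) = 0"
  shows "AE u in lebesgue. G u = 0"
proof -
  have "AE u in lebesgue. G u * exp (- of_real (\<alpha> * (norm u)\<^sup>2)) = 0"
  proof (rule fourier_uniqueness[OF int])
    fix \<xi> :: complex
    define z where "z = \<i> * \<xi> / of_real (2 * \<alpha>)"
    have "- 2 * \<i> * of_real \<alpha> * z = \<xi>" using \<alpha> by (simp add: z_def field_simps)
    then show "(LINT u|lebesgue. cis (\<xi> \<bullet> u) * (G u * exp (- of_real (\<alpha> * (norm u)\<^sup>2)))) = 0"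
      using zero[of z] unfolding exp_mult_kernel_eq_cis by (simp add: mult_ac)
  qed
  then show ?thesis by eventually_elim simp
qed

lemma toeplitz_symbol_unique:
  assumes \<alpha>: "\<alpha> > 0" and f: "f1 \<in> Linf" "f2 \<in> Linf"
    and eq: "\<And>h. h \<in> Fock \<alpha> \<Longrightarrow> toeplitz \<alpha> f1 h = toeplitz \<alpha> f2 h"
  shows "AE u in lebesgue. f1 u = f2 u"
proof -
  have int: "integrable lebesgue (\<lambda>u. exp (a * u) * toeplitz_kernel \<alpha> z u)" for a z
    using Fock_kernel_integrable[OF \<alpha> exp_in_Fock[OF \<alpha>], of 0 a z] by simp
  have "AE u in lebesgue. f1 u - f2 u = 0"
  proof (rule kernel_transform_injective[OF \<alpha>])
    have "integrable lebesgue (\<lambda>u::complex. exp (- complex_of_real (\<alpha> * (norm u)\<^sup>2)))"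
      using int[of 0 0] by (simp add: toeplitz_kernel_def)
    then show "integrable lebesgue (\<lambda>u. (f1 u - f2 u) * exp (- of_real (\<alpha> * (norm u)\<^sup>2)))"
      unfolding left_diff_distrib by (intro Bochner_Integration.integrable_diff integrable_Linf_mult f)
    fix z
    let ?a = "- of_real \<alpha> * cnj z"
    have "toeplitz \<alpha> f1 (\<lambda>u. exp (?a * u)) z = toeplitz \<alpha> f2 (\<lambda>u. exp (?a * u)) z"
      using eq[OF exp_in_Fock[OF \<alpha>, of ?a]] by metis
    then show "(LINT u|lebesgue. (f1 u - f2 u) * (exp (?a * u) * toeplitz_kernel \<alpha> z u)) = 0"
      unfolding left_diff_distrib toeplitz_eq_kernel
      using \<alpha> integrable_Linf_mult[OF f(1) int[of ?a z]] integrable_Linf_mult[OF f(2) int[of ?a z]] by simp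
  qed
  then show ?thesis by simp
qed

lemma toeplitz_cong_AE:
  assumes f: "f1 \<in> Linf" "f2 \<in> Linf" and ae: "AE u in lebesgue. f1 u = f2 u" and \<alpha>: "\<alpha> > 0" and h: "h \<in> Fock \<alpha>"
  shows "toeplitz \<alpha> f1 h = toeplitz \<alpha> f2 h"
proof
  fix z
  have i: "integrable lebesgue (\<lambda>u. h u * toeplitz_kernel \<alpha> z u)"
    using Fock_kernel_integrable[OF \<alpha> h, of 0 z] by simp
  have "(LINT u|lebesgue. f1 u * (h u * toeplitz_kernel \<alpha> z u)) = (LINT u|lebesgue. f2 u * (h u * toeplitz_kernel \<alpha> z u))"
    using integrable_Linf_mult[OF f(1) i] integrable_Linf_mult[OF f(2) i] ae
    by (intro integral_cong_AE) (auto elim: eventually_mono)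
  then show "toeplitz \<alpha> f1 h z = toeplitz \<alpha> f2 h z" by (simp add: toeplitz_eq_kernel)
qed

section \<open>The explicit symbol\<close>

lemma sigma_measurable:
  assumes "g holomorphic_on UNIV"
  shows "sigma_symbol \<alpha> lam g \<in> borel_measurable borel"
proof -
  have "deriv g holomorphic_on UNIV" using assms by (intro holomorphic_deriv) auto
  note [measurable] = borel_measurable_entire[OF this]
  show ?thesis unfolding sigma_symbol_def[abs_def] by measurable
qed

lemma sigma_mult_kernel:
  assumes "\<alpha> \<noteq> 0" "lam \<noteq> 0"
  shows "sigma_symbol \<alpha> lam g u * toeplitz_kernel \<alpha> z u
    = 1 / (of_real \<alpha> * lam) * (exp (- (of_real \<alpha> / lam) * of_real ((norm u)\<^sup>2) + (of_real \<alpha> / lam) * (lam * z) * cnj u) * deriv g (u / lam) / cnj u)"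
proof -
  have "exp (of_real \<alpha> * ((lam - 1) / lam) * of_real ((norm u)\<^sup>2)) * toeplitz_kernel \<alpha> z u
     = exp (- (of_real \<alpha> / lam) * of_real ((norm u)\<^sup>2) + (of_real \<alpha> / lam) * (lam * z) * cnj u)"
    unfolding toeplitz_kernel_def exp_add[symmetric]
    by (rule arg_cong[where f=exp]) (use assms in \<open>simp add: field_simps\<close>)
  then show ?thesis unfolding sigma_symbol_def
    by (simp add: mult_ac)
qed

lemma Re_of_real_mult_mult: "Re (of_real x * q * of_real y) = x * Re q * y"
  by simp

text \<open>
  Boundedness, which holds almost everywhere, extends to all \<open>w \<noteq> 0\<close> by continuity and reads
  \<open>|g' (w / lam)| \<le> C \<alpha> |lam| |w| exp (- \<alpha> \<delta> |w|\<^sup>2)\<close> with \<open>\<delta> = 1 - Re (1 / lam)\<close>. Letting \<open>w\<close> tend to \<open>0\<close> gives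
  \<open>g' 0 = 0\<close>. If \<open>\<delta>\<close> were positive, then \<open>g'\<close> would tend to \<open>0\<close> at infinity and vanish.
\<close>

lemma sigma_bounded_imp:
  assumes \<alpha>: "\<alpha> > 0" and g: "g holomorphic_on UNIV" and nz: "deriv g z1 \<noteq> 0"
    and lam: "lam \<noteq> 0" and \<sigma>: "sigma_symbol \<alpha> lam g \<in> Linf"
  shows "deriv g 0 = 0" and "Re lam \<ge> (norm lam)\<^sup>2"
proof -
  have g': "deriv g holomorphic_on UNIV" using g by (intro holomorphic_deriv) auto
  have contg': "continuous_on UNIV (deriv g)" using g' by (rule holomorphic_on_imp_continuous_on)
  define \<delta> where "\<delta> = Re ((lam - 1) / lam)"
  obtain C where C: "C \<ge> 0" "AE w in lebesgue. norm (sigma_symbol \<alpha> lam g w) \<le> C"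
    using Linf_bound[OF \<sigma>] by blast
  have bound: "norm (sigma_symbol \<alpha> lam g w) \<le> C" if "w \<noteq> 0" for w
  proof (rule AE_le_imp_le_on_open[where U="- {0}" and k="\<lambda>w. norm (sigma_symbol \<alpha> lam g w)"])
    show "continuous_on (- {0}) (\<lambda>w. norm (sigma_symbol \<alpha> lam g w))"
      unfolding sigma_symbol_def using \<alpha> lam
      by (intro continuous_intros continuous_on_compose2[OF contg']) auto
  qed (use C that in auto)
  have g'_bound: "norm (deriv g (w / lam)) \<le> C * \<alpha> * norm lam * norm w * exp (- \<alpha> * \<delta> * (norm w)\<^sup>2)" if "w \<noteq> 0" for w
  proof -
    have "Re (of_real \<alpha> * ((lam - 1) / lam) * of_real ((norm w)\<^sup>2)) = \<alpha> * \<delta> * (norm w)\<^sup>2"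
      unfolding \<delta>_def by (rule Re_of_real_mult_mult)
    then have "norm (sigma_symbol \<alpha> lam g w) = norm (deriv g (w / lam)) * exp (\<alpha> * \<delta> * (norm w)\<^sup>2) / (\<alpha> * norm lam * norm w)"
      using \<alpha> unfolding sigma_symbol_def norm_mult norm_exp_eq_Re norm_divide by simp
    then have "norm (deriv g (w / lam)) * exp (\<alpha> * \<delta> * (norm w)\<^sup>2) \<le> C * (\<alpha> * norm lam * norm w)"
      using bound[OF that] \<alpha> lam that by (simp add: divide_le_eq)
    then show ?thesis by (simp add: exp_minus field_simps)
  qed
  have "((\<lambda>w. deriv g (w / lam)) \<longlongrightarrow> 0) (at 0)"
  proof (rule Lim_null_comparison)
    show "\<forall>\<^sub>F w in at 0. norm (deriv g (w / lam)) \<le> C * \<alpha> * norm lam * norm w * exp (- \<alpha> * \<delta> * (norm w)\<^sup>2)"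
      using g'_bound by (simp add: eventually_at_filter)
    show "((\<lambda>w::complex. C * \<alpha> * norm lam * norm w * exp (- \<alpha> * \<delta> * (norm w)\<^sup>2)) \<longlongrightarrow> 0) (at 0)"
      by (auto intro!: tendsto_eq_intros)
  qed
  moreover have "((\<lambda>w. deriv g (w / lam)) \<longlongrightarrow> deriv g (0 / lam)) (at 0)"
    using lam by (intro continuous_on_tendsto_compose[OF contg'] tendsto_intros) auto
  ultimately have "0 = deriv g (0 / lam)"
    by (rule tendsto_unique[OF at_neq_bot])
  then show g0: "deriv g 0 = 0" by simp
  show "Re lam \<ge> (norm lam)\<^sup>2"
  proof (rule ccontr)
    assume neg: "\<not> ?thesis"
    have "Re (1 / lam) = Re lam / (norm lam)\<^sup>2" by (simp add: Re_divide cmod_power2)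
    then have "\<delta> = 1 - Re lam / (norm lam)\<^sup>2"
      using lam by (simp add: \<delta>_def diff_divide_distrib)
    then have d: "\<delta> > 0" using lam neg by simp
    have "deriv g ((lam * z1) / lam) = 0"
    proof (rule entire_gaussian_decay_imp_zero[where k="\<lambda>w. deriv g (w / lam)"])
      show "(\<lambda>w. deriv g (w / lam)) holomorphic_on UNIV"
        using lam by (intro entire_compose[OF g'] holomorphic_intros)
      show "\<alpha> * \<delta> > 0" using \<alpha> d by simp
      show "norm (deriv g (w / lam)) \<le> (C * \<alpha> * norm lam) * exp (1 * norm w - \<alpha> * \<delta> * (norm w)\<^sup>2)" for w
      proof (cases "w = 0")
        case False
        have "norm (deriv g (w / lam)) \<le> (C * \<alpha> * norm lam) * (norm w * exp (- \<alpha> * \<delta> * (norm w)\<^sup>2))"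
          using g'_bound[OF False] by (simp add: mult.assoc)
        also have "\<dots> \<le> (C * \<alpha> * norm lam) * (exp (norm w) * exp (- \<alpha> * \<delta> * (norm w)\<^sup>2))"
          using C \<alpha> by (intro mult_left_mono mult_right_mono less_imp_le[OF exp_gt_self]) auto
        finally show ?thesis by (simp add: exp_add[symmetric])
      qed (use C \<alpha> g0 in simp)
    qed
    with nz lam show False by simp
  qed
qed

lemma Re_divide_of_real_pos:
  assumes "\<alpha> > 0" "Re lam > 0" shows "Re (of_real \<alpha> / lam) > 0"
proof -
  have "lam \<noteq> 0" using assms by auto
  then have "(norm lam)\<^sup>2 > 0" by simp
  then show ?thesis using assms by (simp add: Re_divide cmod_power2)
qed

text \<open>
  The Toeplitz integral of \<open>\<sigma>\<close> is the one in \<open>gaussian_reproducing_primitive\<close> for \<open>c = \<alpha> / lam\<close>,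
  \<open>m u = g' (u / lam) h u\<close> and \<open>w = lam z\<close>. Its value is the Volterra integral along the segment from \<open>0\<close> to \<open>z\<close>. The
  integrability hypothesis holds because \<open>exp (- c |u|\<^sup>2) m u / cnj u\<close> is, up to a constant, the bounded function \<open>\<sigma>\<close> times
  \<open>h u exp (- \<alpha> |u|\<^sup>2)\<close>.
\<close>

lemma volterra_eq_toeplitz_sigma:
  assumes \<alpha>: "\<alpha> > 0" and g: "g holomorphic_on UNIV" and lam: "Re lam > 0"
    and phi: "\<And>z. \<phi> z = lam * z" and \<sigma>: "sigma_symbol \<alpha> lam g \<in> Linf"
  shows "volterra_eq_toeplitz \<alpha> g \<phi> (sigma_symbol \<alpha> lam g)"
  unfolding volterra_eq_toeplitz_def
proof (intro ballI ext)
  fix h z assume h: "h \<in> Fock \<alpha>"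
  have hol: "h holomorphic_on UNIV" using h by (simp add: Fock_def)
  have lam0: "lam \<noteq> 0" using lam by auto
  define c where "c = of_real \<alpha> / lam"
  have c: "Re c > 0" unfolding c_def using \<alpha> lam by (rule Re_divide_of_real_pos)
  define m where "m u = deriv g (u / lam) * h u" for u
  have g': "deriv g holomorphic_on UNIV" using g by (intro holomorphic_deriv) auto
  have m: "m holomorphic_on UNIV"
    unfolding m_def using lam0
    by (intro holomorphic_on_mult hol entire_compose[OF g'] holomorphic_intros)
  note [measurable] = borel_measurable_entire[OF hol] borel_measurable_entire[OF m] sigma_measurable[OF g]
  have \<sigma>m: "sigma_symbol \<alpha> lam g u * (h u * toeplitz_kernel \<alpha> z u)
     = 1 / (of_real \<alpha> * lam) * (exp (- c * of_real ((norm u)\<^sup>2) + c * (lam * z) * cnj u) * m u / cnj u)" for u z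
  proof -
    have "sigma_symbol \<alpha> lam g u * (h u * toeplitz_kernel \<alpha> z u) = (sigma_symbol \<alpha> lam g u * toeplitz_kernel \<alpha> z u) * h u"
      by (simp add: mult_ac)
    also have "\<dots> = 1 / (of_real \<alpha> * lam) * (exp (- c * of_real ((norm u)\<^sup>2) + c * (lam * z) * cnj u) * m u / cnj u)"
      using \<alpha> lam0 by (subst sigma_mult_kernel) (simp_all add: m_def c_def mult_ac)
    finally show ?thesis .
  qed
  have int: "integrable lborel (\<lambda>u. exp (K * norm u) * norm (exp (- c * of_real ((norm u)\<^sup>2)) * m u / cnj u))" for K
  proof -
    have "integrable lebesgue (\<lambda>u. sigma_symbol \<alpha> lam g u * of_real (exp (K * norm u - \<alpha> * (norm u)\<^sup>2) * norm (h u)))"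
      using Fock_integrable_exp[OF \<alpha> h, of K]
      by (intro integrable_Linf_mult[OF \<sigma>], subst integrable_lebesgue_iff_lborel) (auto intro!: integrable_of_real simp del: of_real_mult)
    then have "integrable lborel (\<lambda>u. sigma_symbol \<alpha> lam g u * of_real (exp (K * norm u - \<alpha> * (norm u)\<^sup>2) * norm (h u)))"
      by (subst (asm) integrable_lebesgue_iff_lborel) auto
    then have "integrable lborel (\<lambda>u. norm (of_real \<alpha> * lam) * norm (sigma_symbol \<alpha> lam g u * of_real (exp (K * norm u - \<alpha> * (norm u)\<^sup>2) * norm (h u))))"
      by (intro integrable_mult_right integrable_norm)
    also have "(\<lambda>u. norm (of_real \<alpha> * lam) * norm (sigma_symbol \<alpha> lam g u * of_real (exp (K * norm u - \<alpha> * (norm u)\<^sup>2) * norm (h u))))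
       = (\<lambda>u. exp (K * norm u) * norm (exp (- c * of_real ((norm u)\<^sup>2)) * m u / cnj u))"
    proof
      fix u
      have "exp (- c * of_real ((norm u)\<^sup>2)) * m u / cnj u = of_real \<alpha> * lam * (sigma_symbol \<alpha> lam g u * (h u * toeplitz_kernel \<alpha> 0 u))"
        unfolding \<sigma>m using \<alpha> lam0 by simp
      moreover have "norm (toeplitz_kernel \<alpha> 0 u) = exp (- (\<alpha> * (norm u)\<^sup>2))"
        by (simp add: toeplitz_kernel_def)
      ultimately have "norm (exp (- c * of_real ((norm u)\<^sup>2)) * m u / cnj u)
          = norm (of_real \<alpha> * lam) * (norm (sigma_symbol \<alpha> lam g u) * (norm (h u) * exp (- (\<alpha> * (norm u)\<^sup>2))))"
        by (simp only: norm_mult)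
      moreover have n: "norm (complex_of_real (exp (K * norm u - \<alpha> * (norm u)\<^sup>2) * norm (h u)))
          = exp (K * norm u) * (norm (h u) * exp (- (\<alpha> * (norm u)\<^sup>2)))"
        by (simp only: norm_of_real) (simp add: abs_mult exp_diff exp_minus divide_inverse)
      ultimately show "norm (of_real \<alpha> * lam) * norm (sigma_symbol \<alpha> lam g u * of_real (exp (K * norm u - \<alpha> * (norm u)\<^sup>2) * norm (h u)))
       = exp (K * norm u) * norm (exp (- c * of_real ((norm u)\<^sup>2)) * m u / cnj u)"
        by (simp only: norm_mult[of "sigma_symbol \<alpha> lam g u"] n mult_ac)
    qed
    finally show ?thesis .
  qed
  have "toeplitz \<alpha> (sigma_symbol \<alpha> lam g) h z = of_real (\<alpha> / pi) *
      (LINT u|lborel. sigma_symbol \<alpha> lam g u * (h u * toeplitz_kernel \<alpha> z u))"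
    unfolding toeplitz_eq_kernel by (subst integrable_lebesgue_iff_lborel(2)) auto
  also have "\<dots> = of_real (\<alpha> / pi) * (1 / (of_real \<alpha> * lam) *
      (LINT u|lborel. exp (- c * of_real ((norm u)\<^sup>2) + c * (lam * z) * cnj u) * m u / cnj u))"
    unfolding \<sigma>m by (subst integral_mult_right_zero) simp
  also have "\<dots> = z * (LINT t:{0..1}|lborel. m (of_real t * (lam * z)))"
    unfolding gaussian_reproducing_primitive[OF c m int] using \<alpha> lam0 by simp
  also have "\<dots> = volterra g \<phi> h z"
  proof -
    have phih: "\<phi> holomorphic_on UNIV"
      by (rule holomorphic_transform[of "\<lambda>z. lam * z"]) (auto simp: phi intro!: holomorphic_intros)
    have "m (of_real t * (lam * z)) = h (\<phi> (of_real t * z)) * deriv g (of_real t * z)" for t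
      using lam0 by (simp add: m_def phi mult_ac)
    then show ?thesis
      unfolding volterra_eq_set_integral[OF g phih hol] by simp
  qed
  finally show "volterra g \<phi> h z = toeplitz \<alpha> (sigma_symbol \<alpha> lam g) h z" by simp
qed

section \<open>Identification of a bounded symbol\<close>
text \<open>
  The hypothesis is the vanishing of the Fourier transform of \<open>k\<close> restricted to \<open>0 \<le> t \<le> 1\<close>. So \<open>k\<close> vanishes on a real
  segment, and everywhere by analytic continuation.
\<close>

lemma exponential_segment_moments_zero:
  fixes k :: "complex \<Rightarrow> complex"
  assumes k: "k holomorphic_on UNIV"
    and zero: "\<And>\<xi>::real. (LINT t:{0..1}|lborel. k (of_real t) * cis (\<xi> * t)) = 0"
  shows "k z = 0"
proof -
  have cont: "continuous_on UNIV k" using k by (rule holomorphic_on_imp_continuous_on)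
  define F where "F t = indicator {0..1::real} t *\<^sub>R k (of_real t)" for t
  have "set_integrable lborel {0..1} (\<lambda>t. k (of_real t))"
    by (rule borel_integrable_atLeastAtMost') (intro continuous_intros continuous_on_compose2[OF cont]; simp)
  then have F: "integrable lborel F" by (simp add: F_def[abs_def] set_integrable_def)
  then have Fm [measurable]: "F \<in> borel_measurable borel" by simp
  have "AE t in lebesgue. F t = 0"
  proof (rule fourier_uniqueness)
    show "integrable lebesgue F" using F Fm by (simp add: integrable_lebesgue_iff_lborel)
    fix \<xi> :: real
    have "(LINT t|lebesgue. cis (\<xi> \<bullet> t) * F t) = (LINT t|lborel. cis (\<xi> \<bullet> t) * F t)"
    proof (rule integrable_lebesgue_iff_lborel(2))
      have [measurable]: "(\<lambda>t. cis (\<xi> \<bullet> t)) \<in> borel_measurable borel"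
        by (intro borel_measurable_continuous_onI continuous_intros)
      show "(\<lambda>t. cis (\<xi> \<bullet> t) * F t) \<in> borel_measurable borel" by measurable
    qed
    also have "\<dots> = (LINT t:{0..1}|lborel. k (of_real t) * cis (\<xi> * t))"
      by (simp add: set_lebesgue_integral_def F_def mult_ac scaleR_conv_of_real)
    finally show "(LINT t|lebesgue. cis (\<xi> \<bullet> t) * F t) = 0" by (simp add: zero)
  qed
  then have ae: "AE t in lebesgue. t \<in> {0<..<1} \<longrightarrow> norm (k (of_real t)) \<le> 0"
    by eventually_elim (auto simp: F_def)
  have "norm (k (of_real t)) \<le> 0" if "t \<in> {0<..<1}" for t
  proof (rule AE_le_imp_le_on_open[OF _ _ ae that])
    show "continuous_on {0<..<1} (\<lambda>t::real. norm (k (of_real t)))"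
      by (intro continuous_intros continuous_on_compose2[OF cont]) auto
  qed simp
  then have k0: "k (of_real t) = 0" if "t \<in> {0<..<1}" for t using that by auto
  show ?thesis
  proof (rule analytic_continuation[OF k, where U="of_real ` {0<..<1}" and \<xi>="of_real (1 / 2)"])
    show "of_real (1 / 2) islimpt (of_real ` {0<..<1::real} :: complex set)"
      unfolding islimpt_approachable
    proof (intro allI impI)
      fix e :: real assume "e > 0"
      define t where "t = 1 / 2 + min (e / 2) (1 / 4)"
      have t: "t \<in> {0<..<1}" "t \<noteq> 1 / 2" "dist t (1 / 2) < e"
        using \<open>e > 0\<close> by (auto simp: t_def dist_real_def min_def)
      show "\<exists>x'\<in>of_real ` {0<..<1}. x' \<noteq> complex_of_real (1 / 2) \<and> dist x' (of_real (1 / 2)) < e"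
      proof (intro bexI conjI)
        show "complex_of_real t \<noteq> of_real (1 / 2)" using t(2) by (metis of_real_eq_iff)
        show "dist (complex_of_real t) (of_real (1 / 2)) < e" using t(3) by (metis dist_of_real)
      qed (use t(1) in blast)
    qed
  qed (use k0 in auto)
qed

context volterra_toeplitz
begin

text \<open>
  For \<open>\<phi> z = lam z + b\<close> the exponent in \<open>deriv_growth\<close> is \<open>\<alpha> (Re lam - |lam|\<^sup>2) |z|\<^sup>2\<close> plus terms of at most linear growth.
\<close>

lemma affine_multiplier:
  assumes nz: "deriv g z1 \<noteq> 0" and phi_eq: "\<And>z. \<phi> z = lam * z + b"
  shows "lam \<noteq> 0" "Re lam \<ge> (norm lam)\<^sup>2"
proof -
  show lam: "lam \<noteq> 0"
    using deriv_zero_if_phi_constant[of b z1] phi_eq nz by auto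
  obtain A where A: "A \<ge> 0"
    "\<And>z. norm (deriv g z) \<le> A * (1 + norm (\<phi> z)) * exp (\<alpha> * (Re (cnj z * \<phi> z) - (norm (\<phi> z))\<^sup>2))"
    using deriv_growth by blast
  show "Re lam \<ge> (norm lam)\<^sup>2"
  proof (rule ccontr)
    assume neg: "\<not> ?thesis"
    define \<delta> where "\<delta> = (norm lam)\<^sup>2 - Re lam"
    define q where "q = cnj b - 2 * cnj b * lam"
    have d: "\<alpha> * \<delta> > 0" using neg alpha by (simp add: \<delta>_def)
    have "deriv g z1 = 0"
    proof (rule entire_gaussian_decay_imp_zero[OF g' d])
      fix z
      have "1 + norm (\<phi> z) \<le> exp (norm (\<phi> z))" by (rule exp_ge_add_one_self)
      also have "\<dots> \<le> exp (norm lam * norm z + norm b)"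
        unfolding phi_eq using norm_triangle_ineq[of "lam * z" b] by (simp add: norm_mult)
      finally have 1: "1 + norm (\<phi> z) \<le> exp (norm lam * norm z + norm b)" .
      have "Re (cnj z * \<phi> z) - (norm (\<phi> z))\<^sup>2 = - \<delta> * (norm z)\<^sup>2 + Re (q * z) - (norm b)\<^sup>2"
        unfolding phi_eq \<delta>_def q_def cmod_power2 by (simp add: power2_eq_square algebra_simps)
      also have "\<dots> \<le> - \<delta> * (norm z)\<^sup>2 + norm q * norm z"
        using complex_Re_le_cmod[of "q * z"] zero_le_power2[of "norm b"] unfolding norm_mult by linarith
      finally have "\<alpha> * (Re (cnj z * \<phi> z) - (norm (\<phi> z))\<^sup>2) \<le> \<alpha> * (- \<delta> * (norm z)\<^sup>2 + norm q * norm z)"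
        using alpha by (intro mult_left_mono) auto
      then have 2: "exp (\<alpha> * (Re (cnj z * \<phi> z) - (norm (\<phi> z))\<^sup>2)) \<le> exp (\<alpha> * (- \<delta> * (norm z)\<^sup>2 + norm q * norm z))"
        by (simp only: exp_le_cancel_iff)
      have "norm (deriv g z) \<le> A * ((1 + norm (\<phi> z)) * exp (\<alpha> * (Re (cnj z * \<phi> z) - (norm (\<phi> z))\<^sup>2)))"
        using A(2)[of z] by (simp add: mult.assoc)
      also have "\<dots> \<le> A * (exp (norm lam * norm z + norm b) * exp (\<alpha> * (- \<delta> * (norm z)\<^sup>2 + norm q * norm z)))"
        by (intro mult_left_mono mult_mono 1 2 A(1)) auto
      also have "\<dots> = A * exp (norm b) * exp ((norm lam + \<alpha> * norm q) * norm z - \<alpha> * \<delta> * (norm z)\<^sup>2)"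
        unfolding mult.assoc exp_add[symmetric] by (simp add: algebra_simps)
      finally show "norm (deriv g z) \<le> A * exp (norm b) * exp ((norm lam + \<alpha> * norm q) * norm z - \<alpha> * \<delta> * (norm z)\<^sup>2)" .
    qed
    with nz show False ..
  qed
qed

lemma gaussian_exponent_pos:
  assumes nz: "deriv g z1 \<noteq> 0" and phi_eq: "\<And>z. \<phi> z = lam * z + b"
  shows "Re (of_real \<alpha> / lam) > 0"
proof (rule Re_divide_of_real_pos[OF alpha])
  have "(norm lam)\<^sup>2 > 0" using affine_multiplier(1)[OF nz phi_eq] by simp
  then show "Re lam > 0" using affine_multiplier(2)[OF nz phi_eq] by linarith
qed

text \<open>
  In the variable \<open>u = \<phi> z\<close> the growth bound loses its dependence on \<open>lam\<close>: the factor \<open>exp (- c |u|\<^sup>2)\<close> removes exactly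
  the part \<open>exp (\<alpha> Re (1 / lam) |u|\<^sup>2)\<close>, and the full Gaussian weight of the Fock space remains.
\<close>

lemma translated_deriv_growth:
  assumes nz: "deriv g z1 \<noteq> 0" and phi_eq: "\<And>z. \<phi> z = lam * z + b"
  defines "c \<equiv> of_real \<alpha> / lam"
  obtains A K where "A \<ge> 0"
    "\<And>u. norm (exp (- c * of_real ((norm u)\<^sup>2)) * deriv g ((u - b) / lam)) \<le> A * exp (K * norm u - \<alpha> * (norm u)\<^sup>2)"
proof -
  note lam = affine_multiplier(1)[OF nz phi_eq]
  obtain A where A: "A \<ge> 0"
    "\<And>z. norm (deriv g z) \<le> A * (1 + norm (\<phi> z)) * exp (\<alpha> * (Re (cnj z * \<phi> z) - (norm (\<phi> z))\<^sup>2))"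
    using deriv_growth by blast
  define K where "K = 1 + \<alpha> * norm (b / lam)"
  have "norm (exp (- c * of_real ((norm u)\<^sup>2)) * deriv g ((u - b) / lam)) \<le> A * exp (K * norm u - \<alpha> * (norm u)\<^sup>2)" for u
  proof -
    let ?z = "(u - b) / lam"
    have \<phi>z: "\<phi> ?z = u" using lam by (simp add: phi_eq)
    have "cnj ?z * u = cnj (1 / lam) * (u * cnj u) - cnj (b / lam) * u"
      using lam by (simp add: field_simps)
    also have "u * cnj u = of_real ((norm u)\<^sup>2)" by (simp add: of_real_norm_square)
    finally have "Re (cnj ?z * u) = Re (cnj (1 / lam) * of_real ((norm u)\<^sup>2)) - Re (cnj (b / lam) * u)"
      by (simp only: minus_complex.sel)
    also have "Re (cnj (1 / lam) * of_real ((norm u)\<^sup>2)) = Re (1 / lam) * (norm u)\<^sup>2"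
      by (simp del: of_real_power complex_cnj_divide)
    also have "Re (1 / lam) * (norm u)\<^sup>2 - Re (cnj (b / lam) * u) \<le> Re (1 / lam) * (norm u)\<^sup>2 + norm (b / lam) * norm u"
      using abs_Re_le_cmod[of "cnj (b / lam) * u"] unfolding norm_mult complex_mod_cnj by linarith
    finally have "\<alpha> * (Re (cnj ?z * u) - (norm u)\<^sup>2) \<le> \<alpha> * (Re (1 / lam) * (norm u)\<^sup>2 + norm (b / lam) * norm u - (norm u)\<^sup>2)"
      using alpha by (intro mult_left_mono) auto
    then have 2: "exp (\<alpha> * (Re (cnj ?z * u) - (norm u)\<^sup>2)) \<le> exp (\<alpha> * (Re (1 / lam) * (norm u)\<^sup>2 + norm (b / lam) * norm u - (norm u)\<^sup>2))"
      by (simp only: exp_le_cancel_iff)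
    have "norm (deriv g ?z) \<le> A * ((1 + norm u) * exp (\<alpha> * (Re (cnj ?z * u) - (norm u)\<^sup>2)))"
      using A(2)[of ?z] unfolding \<phi>z by (simp add: mult.assoc)
    also have "\<dots> \<le> A * (exp (norm u) * exp (\<alpha> * (Re (1 / lam) * (norm u)\<^sup>2 + norm (b / lam) * norm u - (norm u)\<^sup>2)))"
      by (intro mult_left_mono mult_mono 2 A(1) exp_ge_add_one_self) auto
    finally have 3: "norm (deriv g ?z) \<le> A * (exp (norm u) * exp (\<alpha> * (Re (1 / lam) * (norm u)\<^sup>2 + norm (b / lam) * norm u - (norm u)\<^sup>2)))" .
    have "c = of_real \<alpha> * (1 / lam)" by (simp add: c_def)
    then have "Re (- c * of_real ((norm u)\<^sup>2)) = - (\<alpha> * Re (1 / lam) * (norm u)\<^sup>2)"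
      unfolding mult_minus_left uminus_complex.sel by (metis Re_of_real_mult_mult)
    then have "norm (exp (- c * of_real ((norm u)\<^sup>2)) * deriv g ?z) = exp (- (\<alpha> * Re (1 / lam) * (norm u)\<^sup>2)) * norm (deriv g ?z)"
      unfolding norm_mult norm_exp_eq_Re by simp
    also have "\<dots> \<le> exp (- (\<alpha> * Re (1 / lam) * (norm u)\<^sup>2)) * (A * (exp (norm u) * exp (\<alpha> * (Re (1 / lam) * (norm u)\<^sup>2 + norm (b / lam) * norm u - (norm u)\<^sup>2))))"
      by (intro mult_left_mono 3) auto
    also have "\<dots> = A * exp (- (\<alpha> * Re (1 / lam) * (norm u)\<^sup>2) + (norm u + \<alpha> * (Re (1 / lam) * (norm u)\<^sup>2 + norm (b / lam) * norm u - (norm u)\<^sup>2)))"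
      by (simp only: exp_add mult_ac)
    also have "- (\<alpha> * Re (1 / lam) * (norm u)\<^sup>2) + (norm u + \<alpha> * (Re (1 / lam) * (norm u)\<^sup>2 + norm (b / lam) * norm u - (norm u)\<^sup>2))
       = K * norm u - \<alpha> * (norm u)\<^sup>2"
      by (simp add: K_def algebra_simps)
    finally show ?thesis .
  qed
  with A(1) that show thesis by blast
qed

text \<open>
  The right-hand side, multiplied by \<open>exp (\<alpha> |u|\<^sup>2)\<close>, is a function \<open>S\<close> whose transform is given by
  \<open>gaussian_reproducing\<close> at the point \<open>w = lam z + b\<close>: it is \<open>(\<pi>/\<alpha>\<^sup>2) exp (a \<phi>(z)) g'(z)\<close>. By \<open>derivative_identity\<close>
  the function \<open>f cnj u\<close> has the same transform. Working with \<open>f cnj u\<close> instead of \<open>f\<close> keeps the singularity at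
  \<open>0\<close> out of the argument.
\<close>

lemma symbol_times_cnj:
  assumes nz: "deriv g z1 \<noteq> 0" and phi_eq: "\<And>z. \<phi> z = lam * z + b"
  defines "c \<equiv> of_real \<alpha> / lam"
  shows "AE u in lebesgue. f u * cnj u * exp (- of_real (\<alpha> * (norm u)\<^sup>2))
     = 1 / (of_real \<alpha> * lam) * (exp (- c * of_real ((norm u)\<^sup>2) + c * b * cnj u) * deriv g ((u - b) / lam))"
proof -
  note lam = affine_multiplier(1)[OF nz phi_eq]
  have c: "Re c > 0" unfolding c_def by (rule gaussian_exponent_pos[OF nz phi_eq])
  define m where "m u = deriv g ((u - b) / lam)" for u
  have m: "m holomorphic_on UNIV"
    unfolding m_def using lam
    by (intro entire_compose[OF g'] holomorphic_intros)
  note [measurable] = borel_measurable_entire[OF m]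
  obtain A K0 where A: "A \<ge> 0"
    and m_bound: "\<And>u. norm (exp (- c * of_real ((norm u)\<^sup>2)) * m u) \<le> A * exp (K0 * norm u - \<alpha> * (norm u)\<^sup>2)"
    using translated_deriv_growth[OF nz phi_eq] unfolding c_def m_def by blast
  define S where "S u = 1 / (of_real \<alpha> * lam) * (exp ((of_real \<alpha> - c) * of_real ((norm u)\<^sup>2) + c * b * cnj u) * m u)" for u
  have Sk: "S u * (exp (a * u) * toeplitz_kernel \<alpha> z u)
      = 1 / (of_real \<alpha> * lam) * (exp (- c * of_real ((norm u)\<^sup>2) + c * (lam * z + b) * cnj u) * (exp (a * u) * m u))" for u a z
  proof -
    have "c * lam = of_real \<alpha>" using lam by (simp add: c_def)
    then have "(of_real \<alpha> - c) * of_real ((norm u)\<^sup>2) + c * b * cnj u + (of_real \<alpha> * z * cnj u - of_real (\<alpha> * (norm u)\<^sup>2))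
       = - c * of_real ((norm u)\<^sup>2) + (c * lam * z + c * b) * cnj u"
      by (simp add: algebra_simps)
    then have "exp ((of_real \<alpha> - c) * of_real ((norm u)\<^sup>2) + c * b * cnj u) * toeplitz_kernel \<alpha> z u
      = exp (- c * of_real ((norm u)\<^sup>2) + c * (lam * z + b) * cnj u)"
      unfolding toeplitz_kernel_def exp_add[symmetric] by (simp add: distrib_left mult.assoc)
    then show ?thesis by (simp add: S_def mult_ac)
  qed
  have int: "integrable lborel (\<lambda>u. exp (- c * of_real ((norm u)\<^sup>2) + c * w * cnj u) * (exp (a * u) * m u))" for a w
  proof (rule Bochner_Integration.integrable_bound)
    show "integrable lborel (\<lambda>u::complex. A * exp ((norm (c * w) + norm a + K0) * norm u - \<alpha> * (norm u)\<^sup>2))"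
      by (intro integrable_mult_right integrable_gaussian_exp alpha)
    show "AE u in lborel. norm (exp (- c * of_real ((norm u)\<^sup>2) + c * w * cnj u) * (exp (a * u) * m u))
       \<le> norm (A * exp ((norm (c * w) + norm a + K0) * norm u - \<alpha> * (norm u)\<^sup>2))"
    proof (rule AE_I2)
      fix u
      have e: "norm (exp (c * w * cnj u)) \<le> exp (norm (c * w) * norm u)" "norm (exp (a * u)) \<le> exp (norm a * norm u)"
        using norm_exp[of "c * w * cnj u"] norm_exp[of "a * u"] by (simp_all add: norm_mult)
      have "norm (exp (- c * of_real ((norm u)\<^sup>2) + c * w * cnj u) * (exp (a * u) * m u))
        = norm (exp (c * w * cnj u)) * norm (exp (a * u)) * norm (exp (- c * of_real ((norm u)\<^sup>2)) * m u)"
        by (simp only: exp_add norm_mult mult_ac)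
      also have "\<dots> \<le> exp (norm (c * w) * norm u) * exp (norm a * norm u) * (A * exp (K0 * norm u - \<alpha> * (norm u)\<^sup>2))"
        by (intro mult_mono e m_bound) auto
      also have "\<dots> = A * exp (norm (c * w) * norm u + norm a * norm u + (K0 * norm u - \<alpha> * (norm u)\<^sup>2))"
        by (simp only: exp_add mult_ac)
      also have "norm (c * w) * norm u + norm a * norm u + (K0 * norm u - \<alpha> * (norm u)\<^sup>2)
          = (norm (c * w) + norm a + K0) * norm u - \<alpha> * (norm u)\<^sup>2"
        by (simp add: algebra_simps)
      finally show "norm (exp (- c * of_real ((norm u)\<^sup>2) + c * w * cnj u) * (exp (a * u) * m u))
       \<le> norm (A * exp ((norm (c * w) + norm a + K0) * norm u - \<alpha> * (norm u)\<^sup>2))"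
        using A by (simp add: abs_mult)
    qed
  qed measurable
  have Sint: "integrable lebesgue (\<lambda>u. S u * (exp (a * u) * toeplitz_kernel \<alpha> z u))" for a z
    unfolding Sk using int[of "lam * z + b" a] by (subst integrable_lebesgue_iff_lborel) auto
  have fint: "integrable lebesgue (\<lambda>u. f u * cnj u * (exp (a * u) * toeplitz_kernel \<alpha> z u))" for a z
    using integrable_Linf_mult[OF f Fock_kernel_integrable[OF alpha exp_in_Fock[OF alpha], of 1 a z]] by (simp add: mult.assoc)
  have "AE u in lebesgue. f u * cnj u - S u = 0"
  proof (rule kernel_transform_injective[OF alpha])
    show "integrable lebesgue (\<lambda>u. (f u * cnj u - S u) * exp (- of_real (\<alpha> * (norm u)\<^sup>2)))"
      unfolding left_diff_distrib using Sint[of 0 0] fint[of 0 0] by (simp add: toeplitz_kernel_def)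
    fix z
    define a where "a = - of_real \<alpha> * cnj z"
    have "(LINT u|lebesgue. S u * (exp (a * u) * toeplitz_kernel \<alpha> z u))
       = 1 / (of_real \<alpha> * lam) * (LINT u|lborel. exp (- c * of_real ((norm u)\<^sup>2) + c * (lam * z + b) * cnj u) * (exp (a * u) * m u))"
      unfolding Sk by (subst integrable_lebesgue_iff_lborel(2)) auto
    also have "\<dots> = 1 / (of_real \<alpha> * lam) * (of_real pi / c * (exp (a * (lam * z + b)) * m (lam * z + b)))"
      using m by (subst gaussian_reproducing[OF c _ int]) (auto intro!: holomorphic_intros)
    also have "\<dots> = of_real (pi / \<alpha>\<^sup>2) * (exp (a * \<phi> z) * deriv g z)"
      using lam by (simp add: m_def c_def phi_eq power2_eq_square)
    finally have S: "(LINT u|lebesgue. S u * (exp (a * u) * toeplitz_kernel \<alpha> z u)) = of_real (pi / \<alpha>\<^sup>2) * (exp (a * \<phi> z) * deriv g z)" .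
    have "exp (a * \<phi> z) * deriv g z = of_real (\<alpha>\<^sup>2 / pi) * (LINT u|lebesgue. f u * cnj u * (exp (a * u) * toeplitz_kernel \<alpha> z u))"
      using derivative_identity[OF exp_in_Fock[OF alpha], of a z] by (simp add: mult.assoc)
    then have F: "(LINT u|lebesgue. f u * cnj u * (exp (a * u) * toeplitz_kernel \<alpha> z u)) = of_real (pi / \<alpha>\<^sup>2) * (exp (a * \<phi> z) * deriv g z)"
      using alpha by simp
    show "(LINT u|lebesgue. (f u * cnj u - S u) * (exp (- of_real \<alpha> * cnj z * u) * toeplitz_kernel \<alpha> z u)) = 0"
      unfolding left_diff_distrib a_def[symmetric]
      using S F Sint[of a z] fint[of a z] by simp
  qed
  then show ?thesis
  proof eventually_elim
    fix u assume "f u * cnj u - S u = 0"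
    then have "f u * cnj u = S u" by simp
    then have "f u * cnj u * exp (- of_real (\<alpha> * (norm u)\<^sup>2)) = S u * (exp (0 * u) * toeplitz_kernel \<alpha> 0 u)"
      by (simp add: toeplitz_kernel_def)
    then show "f u * cnj u * exp (- of_real (\<alpha> * (norm u)\<^sup>2))
     = 1 / (of_real \<alpha> * lam) * (exp (- c * of_real ((norm u)\<^sup>2) + c * b * cnj u) * deriv g ((u - b) / lam))"
      unfolding Sk by (simp add: m_def)
  qed
qed

lemma AE_nonzero: "AE u::complex in lebesgue. u \<noteq> 0"
  using AE_completion[OF AE_lborel_singleton[of 0]] .

text \<open>
  \<open>V h\<close> vanishes at \<open>0\<close>, hence so does \<open>T\<^sub>f h\<close>. With \<open>f\<close> known from \<open>symbol_times_cnj\<close>, the value of \<open>T\<^sub>f\<close> on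
  \<open>exp (a u)\<close> at \<open>0\<close> is given by \<open>gaussian_reproducing_primitive\<close> at \<open>w = b\<close>: up to a non-zero constant it is \<open>b\<close> times
  the integral of \<open>g' ((t b - b) / lam) exp (a t b)\<close> over \<open>0 \<le> t \<le> 1\<close>. The choice \<open>a = \<i> \<xi> / b\<close> makes this a Fourier
  transform in \<open>t\<close>.
\<close>

lemma phi_fixes_zero:
  assumes nz: "deriv g z1 \<noteq> 0" and phi_eq: "\<And>z. \<phi> z = lam * z + b"
  shows "b = 0"
proof (rule ccontr)
  assume b: "b \<noteq> 0"
  note lam = affine_multiplier(1)[OF nz phi_eq]
  define c where "c = of_real \<alpha> / lam"
  have c: "Re c > 0" unfolding c_def by (rule gaussian_exponent_pos[OF nz phi_eq])
  have ae: "AE u in lebesgue. f u * exp (- of_real (\<alpha> * (norm u)\<^sup>2))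
     = 1 / (of_real \<alpha> * lam) * (exp (- c * of_real ((norm u)\<^sup>2) + c * b * cnj u) * deriv g ((u - b) / lam) / cnj u)"
    using symbol_times_cnj[OF nz phi_eq] AE_nonzero
    unfolding c_def[symmetric]
  proof eventually_elim
    fix u :: complex
    let ?X = "1 / (of_real \<alpha> * lam) * (exp (- c * of_real ((norm u)\<^sup>2) + c * b * cnj u) * deriv g ((u - b) / lam))"
    assume *: "f u * cnj u * exp (- of_real (\<alpha> * (norm u)\<^sup>2)) = ?X" and "u \<noteq> 0"
    then have "f u * exp (- of_real (\<alpha> * (norm u)\<^sup>2)) = ?X / cnj u"
      unfolding *[symmetric] by simp
    then show "f u * exp (- of_real (\<alpha> * (norm u)\<^sup>2))
     = 1 / (of_real \<alpha> * lam) * (exp (- c * of_real ((norm u)\<^sup>2) + c * b * cnj u) * deriv g ((u - b) / lam) / cnj u)"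
      by simp
  qed
  have k: "(\<lambda>s. deriv g ((s * b - b) / lam)) holomorphic_on UNIV"
    using lam by (intro entire_compose[OF g'] holomorphic_intros)
  have "deriv g ((s * b - b) / lam) = 0" for s
  proof (rule exponential_segment_moments_zero[OF k])
    fix \<xi> :: real
    define a where "a = \<i> * of_real \<xi> / b"
    define m where "m u = deriv g ((u - b) / lam) * exp (a * u)" for u
    have m: "m holomorphic_on UNIV"
      unfolding m_def using lam
      by (intro holomorphic_on_mult entire_compose[OF g'] holomorphic_intros)
    note [measurable] = borel_measurable_entire[OF m]
    have ae_m: "AE u in lebesgue. f u * (exp (a * u) * toeplitz_kernel \<alpha> 0 u)
       = 1 / (of_real \<alpha> * lam) * (exp (- c * of_real ((norm u)\<^sup>2) + c * b * cnj u) * m u / cnj u)"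
      using ae
    proof eventually_elim
      fix u assume *: "f u * exp (- of_real (\<alpha> * (norm u)\<^sup>2))
        = 1 / (of_real \<alpha> * lam) * (exp (- c * of_real ((norm u)\<^sup>2) + c * b * cnj u) * deriv g ((u - b) / lam) / cnj u)"
      have "f u * (exp (a * u) * toeplitz_kernel \<alpha> 0 u) = (f u * exp (- of_real (\<alpha> * (norm u)\<^sup>2))) * exp (a * u)"
        by (simp add: toeplitz_kernel_def mult_ac)
      also have "\<dots> = 1 / (of_real \<alpha> * lam) * (exp (- c * of_real ((norm u)\<^sup>2) + c * b * cnj u) * m u / cnj u)"
        unfolding * m_def by (simp add: mult_ac)
      finally show "f u * (exp (a * u) * toeplitz_kernel \<alpha> 0 u)
       = 1 / (of_real \<alpha> * lam) * (exp (- c * of_real ((norm u)\<^sup>2) + c * b * cnj u) * m u / cnj u)" .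
    qed
    obtain C where C: "C \<ge> 0" "AE u in lebesgue. norm (f u) \<le> C" using Linf_bound[OF f] by blast
    have int: "integrable lborel (\<lambda>u. exp (K * norm u) * norm (exp (- c * of_real ((norm u)\<^sup>2)) * m u / cnj u))" for K
    proof -
      have "integrable lebesgue (\<lambda>u. exp (K * norm u) * norm (exp (- c * of_real ((norm u)\<^sup>2)) * m u / cnj u))"
      proof (rule Bochner_Integration.integrable_bound)
        let ?K = "K + norm (c * b) + norm a"
        have "integrable lborel (\<lambda>u::complex. norm (of_real \<alpha> * lam) * C * exp (?K * norm u - \<alpha> * (norm u)\<^sup>2))"
          by (intro integrable_mult_right integrable_gaussian_exp alpha)
        then show "integrable lebesgue (\<lambda>u::complex. norm (of_real \<alpha> * lam) * C * exp (?K * norm u - \<alpha> * (norm u)\<^sup>2))"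
          by (subst integrable_lebesgue_iff_lborel) auto
        show "(\<lambda>u. exp (K * norm u) * norm (exp (- c * of_real ((norm u)\<^sup>2)) * m u / cnj u)) \<in> borel_measurable lebesgue"
          by (intro borel_measurable_lebesgueI) measurable
        show "AE u in lebesgue. norm (exp (K * norm u) * norm (exp (- c * of_real ((norm u)\<^sup>2)) * m u / cnj u))
          \<le> norm (norm (of_real \<alpha> * lam) * C * exp (?K * norm u - \<alpha> * (norm u)\<^sup>2))"
          using ae_m C(2)
        proof eventually_elim
          fix u assume *: "f u * (exp (a * u) * toeplitz_kernel \<alpha> 0 u)
               = 1 / (of_real \<alpha> * lam) * (exp (- c * of_real ((norm u)\<^sup>2) + c * b * cnj u) * m u / cnj u)"
            and Cu: "norm (f u) \<le> C"
          let ?E = "exp (- c * of_real ((norm u)\<^sup>2)) * m u / cnj u"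
          have e: "norm (exp (- (c * b * cnj u))) \<le> exp (norm (c * b) * norm u)" "norm (exp (a * u)) \<le> exp (norm a * norm u)"
            using norm_exp[of "- (c * b * cnj u)"] norm_exp[of "a * u"] by (simp_all add: norm_mult)
          have "of_real \<alpha> * lam * (f u * (exp (a * u) * toeplitz_kernel \<alpha> 0 u)) = exp (c * b * cnj u) * ?E"
            unfolding * exp_add using alpha lam by simp
          then have "?E = of_real \<alpha> * lam * (f u * (exp (a * u) * toeplitz_kernel \<alpha> 0 u)) * exp (- (c * b * cnj u))"
            by (simp add: exp_minus)
          then have "norm ?E = norm (of_real \<alpha> * lam) * (norm (f u) * (norm (exp (a * u)) * norm (toeplitz_kernel \<alpha> 0 u))) * norm (exp (- (c * b * cnj u)))"
            by (simp only: norm_mult)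
          also have "\<dots> \<le> norm (of_real \<alpha> * lam) * (C * (exp (norm a * norm u) * exp (\<alpha> * norm (0::complex) * norm u - \<alpha> * (norm u)\<^sup>2))) * exp (norm (c * b) * norm u)"
            using C(1) by (intro mult_mono mult_left_mono Cu e norm_toeplitz_kernel_le[OF alpha]) auto
          finally have "exp (K * norm u) * norm ?E \<le> exp (K * norm u) * (norm (of_real \<alpha> * lam) * (C * (exp (norm a * norm u) * exp (\<alpha> * norm (0::complex) * norm u - \<alpha> * (norm u)\<^sup>2))) * exp (norm (c * b) * norm u))"
            by (intro mult_left_mono) auto
          also have "\<dots> = norm (of_real \<alpha> * lam) * C * exp (K * norm u + (norm (c * b) * norm u + (norm a * norm u + (\<alpha> * norm (0::complex) * norm u - \<alpha> * (norm u)\<^sup>2))))"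
            by (simp only: exp_add mult_ac)
          also have "K * norm u + (norm (c * b) * norm u + (norm a * norm u + (\<alpha> * norm (0::complex) * norm u - \<alpha> * (norm u)\<^sup>2)))
             = ?K * norm u - \<alpha> * (norm u)\<^sup>2"
            by (simp add: algebra_simps)
          finally show "norm (exp (K * norm u) * norm ?E)
          \<le> norm (norm (of_real \<alpha> * lam) * C * exp (?K * norm u - \<alpha> * (norm u)\<^sup>2))"
            using C(1) by (simp add: abs_mult)
        qed
      qed
      then show ?thesis by (subst (asm) integrable_lebesgue_iff_lborel) auto
    qed
    have "0 = volterra g \<phi> (\<lambda>u. exp (a * u)) 0" by (simp add: volterra_def)
    also have "\<dots> = toeplitz \<alpha> f (\<lambda>u. exp (a * u)) 0"
      using eq exp_in_Fock[OF alpha, of a] by (simp add: volterra_eq_toeplitz_def)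
    also have "\<dots> = of_real (\<alpha> / pi) * (LINT u|lebesgue. 1 / (of_real \<alpha> * lam) * (exp (- c * of_real ((norm u)\<^sup>2) + c * b * cnj u) * m u / cnj u))"
      unfolding toeplitz_eq_kernel
    proof (rule arg_cong[where f="\<lambda>x. of_real (\<alpha> / pi) * x"], rule integral_cong_AE[OF _ _ ae_m])
      show "(\<lambda>u. f u * (exp (a * u) * toeplitz_kernel \<alpha> 0 u)) \<in> borel_measurable lebesgue"
        using integrable_Linf_mult[OF f Fock_kernel_integrable[OF alpha exp_in_Fock[OF alpha], of 0 a 0]] by simp
      show "(\<lambda>u. 1 / (of_real \<alpha> * lam) * (exp (- c * of_real ((norm u)\<^sup>2) + c * b * cnj u) * m u / cnj u)) \<in> borel_measurable lebesgue"
        by (intro borel_measurable_lebesgueI) measurable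
    qed
    also have "\<dots> = of_real (\<alpha> / pi) * (LINT u|lborel. 1 / (of_real \<alpha> * lam) * (exp (- c * of_real ((norm u)\<^sup>2) + c * b * cnj u) * m u / cnj u))"
      by (subst integrable_lebesgue_iff_lborel(2)) auto
    also have "\<dots> = of_real (\<alpha> / pi) * (1 / (of_real \<alpha> * lam) * (LINT u|lborel. exp (- c * of_real ((norm u)\<^sup>2) + c * b * cnj u) * m u / cnj u))"
      by (simp only: integral_mult_right_zero)
    also have "\<dots> = of_real (\<alpha> / pi) * (1 / (of_real \<alpha> * lam) * (of_real pi * b * (LINT t:{0..1}|lborel. m (of_real t * b))))"
      unfolding gaussian_reproducing_primitive[OF c m int] ..
    finally have "(LINT t:{0..1}|lborel. m (of_real t * b)) = 0"
      using alpha lam b by simp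
    moreover have "m (of_real t * b) = deriv g ((of_real t * b - b) / lam) * cis (\<xi> * t)" for t
      using b by (simp add: m_def a_def cis_conv_exp mult_ac)
    ultimately show "(LINT t:{0..1}|lborel. deriv g ((of_real t * b - b) / lam) * cis (\<xi> * t)) = 0"
      by simp
  qed
  from this[of "(lam * z1 + b) / b"] have "deriv g z1 = 0" using b lam by simp
  with nz show False ..
qed

lemma symbol_eq_sigma:
  assumes nz: "deriv g z1 \<noteq> 0"
  obtains lam where "lam \<noteq> 0" "\<And>z. \<phi> z = lam * z" "AE w in lebesgue. f w = sigma_symbol \<alpha> lam g w"
    "sigma_symbol \<alpha> lam g \<in> Linf"
proof -
  obtain lam b where phi_eq: "\<And>z. \<phi> z = lam * z + b" using phi_affine[OF nz] by blast
  have b: "b = 0" by (rule phi_fixes_zero[OF nz phi_eq])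
  note lam = affine_multiplier(1)[OF nz phi_eq]
  have ae: "AE w in lebesgue. f w = sigma_symbol \<alpha> lam g w"
    using symbol_times_cnj[OF nz phi_eq] AE_nonzero
  proof eventually_elim
    fix u :: complex assume *: "f u * cnj u * exp (- of_real (\<alpha> * (norm u)\<^sup>2)) = 1 / (of_real \<alpha> * lam) *
         (exp (- (of_real \<alpha> / lam) * of_real ((norm u)\<^sup>2) + of_real \<alpha> / lam * b * cnj u) * deriv g ((u - b) / lam))"
      and u: "u \<noteq> 0"
    have k: "toeplitz_kernel \<alpha> 0 u = exp (- of_real (\<alpha> * (norm u)\<^sup>2))" by (simp add: toeplitz_kernel_def)
    have "sigma_symbol \<alpha> lam g u * toeplitz_kernel \<alpha> 0 u * cnj u = 1 / (of_real \<alpha> * lam) *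
         (exp (- (of_real \<alpha> / lam) * of_real ((norm u)\<^sup>2) + of_real \<alpha> / lam * b * cnj u) * deriv g ((u - b) / lam))"
      using u alpha lam by (subst sigma_mult_kernel) (simp_all add: b)
    also have "\<dots> = f u * cnj u * toeplitz_kernel \<alpha> 0 u" using * by (simp only: k)
    finally have "sigma_symbol \<alpha> lam g u * (toeplitz_kernel \<alpha> 0 u * cnj u) = f u * (toeplitz_kernel \<alpha> 0 u * cnj u)"
      by (simp only: mult_ac)
    then show "f u = sigma_symbol \<alpha> lam g u"
      using u by (simp add: k)
  qed
  have "sigma_symbol \<alpha> lam g \<in> Linf"
  proof -
    obtain C where C: "AE u in lebesgue. norm (f u) \<le> C" using Linf_bound[OF f] by blast
    from C ae have "AE u in lebesgue. norm (sigma_symbol \<alpha> lam g u) \<le> C"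
      by eventually_elim simp
    then show ?thesis
      using borel_measurable_lebesgueI[OF sigma_measurable[OF g]] by (auto simp: Linf_def)
  qed
  with that lam ae phi_eq b show thesis by simp
qed

end

theorem theorem1p3:
  fixes \<alpha> :: real and g \<phi> :: "complex \<Rightarrow> complex"
  assumes "\<alpha> > 0"
    and "g holomorphic_on UNIV"
    and "\<phi> holomorphic_on UNIV"
  shows
    "((\<exists>f\<in>Linf. volterra_eq_toeplitz \<alpha> g \<phi> f) \<longleftrightarrow>
        (g constant_on UNIV \<or>
         (\<exists>lam::complex. lam \<noteq> 0 \<and> (\<forall>z. \<phi> z = lam * z) \<and> sigma_symbol \<alpha> lam g \<in> Linf)))
     \<and>
     ((\<exists>z. deriv g z \<noteq> 0) \<longrightarrow>
        (\<forall>f1\<in>Linf. \<forall>f2\<in>Linf.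
            volterra_eq_toeplitz \<alpha> g \<phi> f1 \<and> volterra_eq_toeplitz \<alpha> g \<phi> f2 \<longrightarrow>
            (AE w in lebesgue. f1 w = f2 w)) \<and>
        (\<forall>lam::complex. lam \<noteq> 0 \<and> (\<forall>z. \<phi> z = lam * z) \<and> sigma_symbol \<alpha> lam g \<in> Linf \<longrightarrow>
            (\<forall>f\<in>Linf. volterra_eq_toeplitz \<alpha> g \<phi> f \<longleftrightarrow>
                      (AE w in lebesgue. f w = sigma_symbol \<alpha> lam g w))))
     \<and>
     ((\<exists>z. deriv g z \<noteq> 0) \<longrightarrow>
        (\<forall>lam::complex. lam \<noteq> 0 \<and> sigma_symbol \<alpha> lam g \<in> Linf \<longrightarrow>
            deriv g 0 = 0 \<and> Re lam \<ge> (norm lam)\<^sup>2 \<and> (norm lam)\<^sup>2 > 0))"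
proof -
  have vt: "volterra_toeplitz \<alpha> g \<phi> f" if "f \<in> Linf" "volterra_eq_toeplitz \<alpha> g \<phi> f" for f
    using assms that by unfold_locales auto
  have cons: "deriv g 0 = 0 \<and> Re lam \<ge> (norm lam)\<^sup>2 \<and> (norm lam)\<^sup>2 > 0"
    if "deriv g z \<noteq> 0" "lam \<noteq> 0" "sigma_symbol \<alpha> lam g \<in> Linf" for z lam
    using sigma_bounded_imp[OF assms(1,2) that] that by simp
  have sigma: "volterra_eq_toeplitz \<alpha> g \<phi> (sigma_symbol \<alpha> lam g)"
    if "deriv g z \<noteq> 0" "lam \<noteq> 0" "\<forall>z. \<phi> z = lam * z" "sigma_symbol \<alpha> lam g \<in> Linf" for z lam
  proof -
    have "Re lam > 0" using cons[OF that(1,2,4)] by linarith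
    then show ?thesis using that by (intro volterra_eq_toeplitz_sigma assms(1,2)) auto
  qed
  have unique: "AE w in lebesgue. f1 w = f2 w"
    if "f1 \<in> Linf" "f2 \<in> Linf" "volterra_eq_toeplitz \<alpha> g \<phi> f1" "volterra_eq_toeplitz \<alpha> g \<phi> f2" for f1 f2
    using that by (intro toeplitz_symbol_unique[OF assms(1)]) (auto simp: volterra_eq_toeplitz_def)
  have zero_case: "\<exists>f\<in>Linf. volterra_eq_toeplitz \<alpha> g \<phi> f" if "\<forall>z. deriv g z = 0"
  proof
    show "(\<lambda>_. 0) \<in> Linf" by (auto simp: Linf_def)
    show "volterra_eq_toeplitz \<alpha> g \<phi> (\<lambda>_. 0)"
      using that by (simp add: volterra_eq_toeplitz_def volterra_def toeplitz_def fun_eq_iff)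
  qed
  have const: "g constant_on UNIV \<longleftrightarrow> (\<forall>z. deriv g z = 0)"
  proof
    assume "g constant_on UNIV"
    then obtain c where "g = (\<lambda>_. c)" by (auto simp: constant_on_def)
    then show "\<forall>z. deriv g z = 0" by simp
  next
    assume "\<forall>z. deriv g z = 0"
    then have "(g has_field_derivative 0) (at z)" for z
      using holomorphic_derivI[OF assms(2) open_UNIV, of z] by simp
    then show "g constant_on UNIV"
      using has_field_derivative_zero_constant[of UNIV g] by (auto simp: constant_on_def)
  qed
  have iff: "(\<exists>f\<in>Linf. volterra_eq_toeplitz \<alpha> g \<phi> f) \<longleftrightarrow>
        (g constant_on UNIV \<or>
         (\<exists>lam::complex. lam \<noteq> 0 \<and> (\<forall>z. \<phi> z = lam * z) \<and> sigma_symbol \<alpha> lam g \<in> Linf))"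
  proof (cases "\<forall>z. deriv g z = 0")
    case True
    then show ?thesis using zero_case const by blast
  next
    case False
    then obtain z1 where nz: "deriv g z1 \<noteq> 0" by blast
    show ?thesis
      using False const sigma[OF nz] volterra_toeplitz.symbol_eq_sigma[OF vt nz] by metis
  qed
  have sigma_iff: "volterra_eq_toeplitz \<alpha> g \<phi> f \<longleftrightarrow> (AE w in lebesgue. f w = sigma_symbol \<alpha> lam g w)"
    if "deriv g z \<noteq> 0" "lam \<noteq> 0" "\<forall>z. \<phi> z = lam * z" "sigma_symbol \<alpha> lam g \<in> Linf" "f \<in> Linf" for z lam f
  proof
    assume "volterra_eq_toeplitz \<alpha> g \<phi> f"
    then show "AE w in lebesgue. f w = sigma_symbol \<alpha> lam g w"
      using unique sigma that by blast
  next
    assume "AE w in lebesgue. f w = sigma_symbol \<alpha> lam g w"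
    then show "volterra_eq_toeplitz \<alpha> g \<phi> f"
      using sigma[OF that(1-4)] toeplitz_cong_AE[OF that(5,4) _ assms(1)]
      by (simp add: volterra_eq_toeplitz_def)
  qed
  show ?thesis
  proof (intro conjI impI allI ballI)
    show "(\<exists>f\<in>Linf. volterra_eq_toeplitz \<alpha> g \<phi> f) \<longleftrightarrow>
        (g constant_on UNIV \<or>
         (\<exists>lam::complex. lam \<noteq> 0 \<and> (\<forall>z. \<phi> z = lam * z) \<and> sigma_symbol \<alpha> lam g \<in> Linf))"
      by (rule iff)
  next
    fix f1 f2 assume "f1 \<in> Linf" "f2 \<in> Linf" "volterra_eq_toeplitz \<alpha> g \<phi> f1 \<and> volterra_eq_toeplitz \<alpha> g \<phi> f2"
    then show "AE w in lebesgue. f1 w = f2 w" by (intro unique) auto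
  next
    fix lam f assume "\<exists>z. deriv g z \<noteq> 0"
      "lam \<noteq> 0 \<and> (\<forall>z. \<phi> z = lam * z) \<and> sigma_symbol \<alpha> lam g \<in> Linf" "f \<in> Linf"
    then show "volterra_eq_toeplitz \<alpha> g \<phi> f \<longleftrightarrow> (AE w in lebesgue. f w = sigma_symbol \<alpha> lam g w)"
      using sigma_iff by blast
  next
    fix lam assume *: "\<exists>z. deriv g z \<noteq> 0" "lam \<noteq> 0 \<and> sigma_symbol \<alpha> lam g \<in> Linf"
    then obtain z where c: "deriv g 0 = 0 \<and> Re lam \<ge> (norm lam)\<^sup>2 \<and> (norm lam)\<^sup>2 > 0"
      using cons by blast
    show "deriv g 0 = 0" "Re lam \<ge> (norm lam)\<^sup>2" "(norm lam)\<^sup>2 > 0"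
      using c by blast+
  qed
qed

end
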